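(* Let $1<p<\infty$ and let $G$ be a locally compact group. If $\mathrm{S}^1(G)$ is any Segal algebra in $L^1(G)$ for which pointwise multiplication satisfies $\mathrm{A}_p(G)\cdot\mathrm{S}^1(G)\subset\mathrm{S}^1(G)$, then $\mathrm{S}^1(G)\supset\mathrm{S}_0^p(G)$.
   Context: $\frac1p+\frac1{p'}=1$. $\mathrm{A}_p(G)$ is the Figà-Talamanca–Herz algebra: the functions $\sum_i\xi_i*\check\eta_i$ with $\xi_i\in L^{p'}(G)$, $\eta_i\in L^p(G)$, $\sum_i\|\xi_i\|_{p'}\|\eta_i\|_p<\infty$ (where $\check\eta(s)=\eta(s^{-1})$), normed by the infimum of these sums; it is a Banach algebra under pointwise operations. Left translation is $(t*u)(s)=u(t^{-1}s)$. A Segal algebra in $L^1(G)$ (in the usual sense of Reiter) is a dense subspace (hence left ideal) $\mathrm{S}^1(G)$ of $L^1(G)$ which is a Banach space under a norm for which the inclusion into $L^1(G)$ is bounded, which is invariant under left translations, with left translations isometric on $\mathrm{S}^1(G)$ and $t\mapsto t*f:G\to\mathrm{S}^1(G)$ continuous for each $f\in\mathrm{S}^1(G)$. $\mathrm{S}_0^p(G)$ (the $p$-Feichtinger Segal algebra), as a space of functions: fix a compact $K\subset G$ with non-empty interior and let $\mathrm{A}_p^K(G)=\{u\in\mathrm{A}_p(G):\operatorname{supp}u\subset K\}$ with the norm of $\mathrm{A}_p(G)$; then $\mathrm{S}_0^p(G)=\{\sum_{t\in G}t*v_t: v_t\in\mathrm{A}_p^K(G),\ \sum_{t\in G}\|v_t\|_{\mathrm{A}_p}<\infty\}$.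 (As a set it does not depend on the choice of $K$; more generally $\mathrm{A}_p^K(G)$ may be replaced by any non-zero compactly supported $p$-operator Segal ideal of $\mathrm{A}_p(G)$.) *)

theory Defs
  imports "HOL-Analysis.Analysis"
begin

text \<open>
  A topological group is a type of class \<^class>\<open>topological_group_add\<close>. This class does not
  assume commutativity; the group law is merely written additively, so that the product $s t$ of
  the mathematical notation is \<open>s + t\<close>, the inverse $s^{-1}$ is \<open>- s\<close>, and $t^{-1} s$ is
  \<open>- t + s\<close> (the order of the summands matters).

  Elements of $L^r(G)$ are represented by complex Borel functions and never by equivalence
  classes. Subspaces of $L^1(G)$ are therefore sets of functions that are closed under almost
  everywhere equality, and norms on them vanish exactly on the functions that are zero almost
  everywhere.
\<close>

text \<open>A left Haar measure: a non-zero left-invariant Radon measure. Since the group need not be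
  \<open>\<sigma>\<close>-compact, inner regularity is only required on open sets.\<close>

definition left_haar_measure :: "'a::{topological_group_add,t2_space} measure \<Rightarrow> bool" where
  "left_haar_measure m \<longleftrightarrow>
     sets m = sets borel \<and>
     emeasure m UNIV \<noteq> 0 \<and>
     (\<forall>C. compact C \<longrightarrow> emeasure m C < \<infinity>) \<and>
     (\<forall>A\<in>sets borel. emeasure m A = (INF U\<in>{U. open U \<and> A \<subseteq> U}. emeasure m U)) \<and>
     (\<forall>U. open U \<longrightarrow> emeasure m U = (SUP C\<in>{C. compact C \<and> C \<subseteq> U}. emeasure m C)) \<and>
     (\<forall>t. \<forall>A\<in>sets borel. emeasure m ((+) t ` A) = emeasure m A)"

definition Lp_fun :: "'a measure \<Rightarrow> real \<Rightarrow> ('a \<Rightarrow> complex) set" where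
  "Lp_fun m r = {f \<in> borel_measurable m. integrable m (\<lambda>s. norm (f s) powr r)}"

definition Lp_norm :: "'a measure \<Rightarrow> real \<Rightarrow> ('a \<Rightarrow> complex) \<Rightarrow> real" where
  "Lp_norm m r f = (\<integral>s. norm (f s) powr r \<partial>m) powr (1 / r)"

definition conj_exponent :: "real \<Rightarrow> real" where
  "conj_exponent p = p / (p - 1)"

lemma conj_exponent: "1 < p \<Longrightarrow> 1 / p + 1 / conj_exponent p = 1"
  by (simp add: conj_exponent_def field_simps)

definition ltranslate :: "'a::group_add \<Rightarrow> ('a \<Rightarrow> complex) \<Rightarrow> 'a \<Rightarrow> complex" where
  "ltranslate t u = (\<lambda>s. u (- t + s))"

definition check_fun :: "('a::group_add \<Rightarrow> complex) \<Rightarrow> 'a \<Rightarrow> complex" where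
  "check_fun f = (\<lambda>s. f (- s))"

definition conv_fun ::
    "'a::group_add measure \<Rightarrow> ('a \<Rightarrow> complex) \<Rightarrow> ('a \<Rightarrow> complex) \<Rightarrow> 'a \<Rightarrow> complex" where
  "conv_fun m f g = (\<lambda>s. \<integral>t. f t * g (- t + s) \<partial>m)"

text \<open>\<open>Ap_repr m p \<xi> \<eta> u\<close>: the sequences \<open>\<xi>\<close> and \<open>\<eta>\<close> represent \<open>u\<close> as an element of the
  Figa-Talamanca--Herz algebra. By Hoelder's inequality every convolution below is defined at
  every point (not just almost everywhere) and the series converges uniformly, so the pointwise
  sum is the intended one.\<close>

definition Ap_repr :: "'a::group_add measure \<Rightarrow> real \<Rightarrow>
    (nat \<Rightarrow> 'a \<Rightarrow> complex) \<Rightarrow> (nat \<Rightarrow> 'a \<Rightarrow> complex) \<Rightarrow> ('a \<Rightarrow> complex) \<Rightarrow> bool" where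
  "Ap_repr m p \<xi> \<eta> u \<longleftrightarrow>
     (\<forall>i. \<xi> i \<in> Lp_fun m (conj_exponent p)) \<and>
     (\<forall>i. \<eta> i \<in> Lp_fun m p) \<and>
     summable (\<lambda>i. Lp_norm m (conj_exponent p) (\<xi> i) * Lp_norm m p (\<eta> i)) \<and>
     (\<forall>s. (\<lambda>i. conv_fun m (\<xi> i) (check_fun (\<eta> i)) s) sums u s)"

definition Ap :: "'a::group_add measure \<Rightarrow> real \<Rightarrow> ('a \<Rightarrow> complex) set" where
  "Ap m p = {u. \<exists>\<xi> \<eta>. Ap_repr m p \<xi> \<eta> u}"

definition Ap_norm :: "'a::group_add measure \<Rightarrow> real \<Rightarrow> ('a \<Rightarrow> complex) \<Rightarrow> real" where
  "Ap_norm m p u =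
     Inf {(\<Sum>i. Lp_norm m (conj_exponent p) (\<xi> i) * Lp_norm m p (\<eta> i)) | \<xi> \<eta>. Ap_repr m p \<xi> \<eta> u}"

definition Ap_supp ::
    "'a::topological_group_add measure \<Rightarrow> real \<Rightarrow> 'a set \<Rightarrow> ('a \<Rightarrow> complex) set" where
  "Ap_supp m p K = {u \<in> Ap m p. closure {s. u s \<noteq> 0} \<subseteq> K}"

text \<open>The $p$-Feichtinger Segal algebra, formed with the compact set \<open>K\<close>. Both sums range over all
  elements of the group; the sum of functions is taken pointwise, where it converges absolutely
  because the supremum norm is dominated by the norm of $A_p(G)$.\<close>

definition S0p ::
    "'a::topological_group_add measure \<Rightarrow> real \<Rightarrow> 'a set \<Rightarrow> ('a \<Rightarrow> complex) set" where
  "S0p m p K = {(\<lambda>s. \<Sum>\<^sub>\<infinity>t. ltranslate t (v t) s) | v.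
     (\<forall>t. v t \<in> Ap_supp m p K) \<and> (\<lambda>t. Ap_norm m p (v t)) summable_on UNIV}"

text \<open>\<open>segal_algebra m S N\<close>: the space \<open>S\<close> with norm \<open>N\<close> is a Segal algebra in $L^1(G)$, where
  $L^1(G)$ is formed with the measure \<open>m\<close>.\<close>

locale segal_algebra =
  fixes m :: "'a::{topological_group_add,t2_space} measure"
    and S :: "('a \<Rightarrow> complex) set"
    and N :: "('a \<Rightarrow> complex) \<Rightarrow> real"
  assumes subset_L1: "f \<in> S \<Longrightarrow> integrable m f"
    and AE_closed: "f \<in> S \<Longrightarrow> g \<in> borel_measurable m \<Longrightarrow> (AE s in m. f s = g s) \<Longrightarrow> g \<in> S"
    and zero_mem: "(\<lambda>_. 0) \<in> S"
    and add_mem: "f \<in> S \<Longrightarrow> g \<in> S \<Longrightarrow> (\<lambda>s. f s + g s) \<in> S"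
    and scale_mem: "f \<in> S \<Longrightarrow> (\<lambda>s. c * f s) \<in> S"
    and dense: "integrable m f \<Longrightarrow> 0 < e \<Longrightarrow> \<exists>g\<in>S. (\<integral>s. norm (f s - g s) \<partial>m) < e"
    and norm_nonneg: "f \<in> S \<Longrightarrow> 0 \<le> N f"
    and norm_eq_0_iff: "f \<in> S \<Longrightarrow> N f = 0 \<longleftrightarrow> (AE s in m. f s = 0)"
    and norm_triangle: "f \<in> S \<Longrightarrow> g \<in> S \<Longrightarrow> N (\<lambda>s. f s + g s) \<le> N f + N g"
    and norm_scale: "f \<in> S \<Longrightarrow> N (\<lambda>s. c * f s) = cmod c * N f"
    and complete:
      "(\<And>n. F n \<in> S) \<Longrightarrow>
       (\<And>e. 0 < e \<Longrightarrow> \<exists>M::nat. \<forall>k\<ge>M. \<forall>n\<ge>M. N (\<lambda>s. F k s - F n s) < e) \<Longrightarrow>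
       \<exists>f\<in>S. (\<lambda>n. N (\<lambda>s. F n s - f s)) \<longlonglongrightarrow> 0"
    and inclusion_bounded: "\<exists>C. \<forall>f\<in>S. (\<integral>s. norm (f s) \<partial>m) \<le> C * N f"
    and ltranslate_mem: "f \<in> S \<Longrightarrow> ltranslate t f \<in> S"
    and ltranslate_isometric: "f \<in> S \<Longrightarrow> N (ltranslate t f) = N f"
    and ltranslate_continuous:
      "f \<in> S \<Longrightarrow> ((\<lambda>t. N (\<lambda>s. ltranslate t f s - ltranslate t\<^sub>0 f s)) \<longlongrightarrow> 0) (at t\<^sub>0)"

end

theory Submission
  imports Defs
begin

text \<open>
  The point is that every \<open>u\<close> in $A_p^K(G)$ lies in $S^1(G)$. If \<open>f\<close> in $S^1(G)$ vanishes
  off a compact set \<open>E\<close>, then the integral of \<open>t * f\<close> over the compact set $K E^{-1}$ exists in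
  $S^1(G)$ by continuity of translation, and on \<open>K\<close> its value at \<open>s\<close> is
  $\int f(t^{-1} s)\,dt = \int f(t^{-1})\,dt$, a constant \<open>c\<close>. Such an \<open>f\<close> is obtained by
  multiplying an element of $S^1(G)$, close in $L^1(G)$ to a non-negative bump function, by a
  compactly supported element of $A_p(G)$ that equals 1 on the support of the bump; closeness
  forces \<open>c\<close> to be non-zero. Hence \<open>c u\<close> is the product of \<open>u\<close> and an element of $S^1(G)$.

  The inclusion of the Banach space $A_p^K(G)$ into $S^1(G)$ has closed graph and is therefore
  bounded, and since translations are isometric on $S^1(G)$ the series defining an element of
  $S_0^p(G)$ converges absolutely in $S^1(G)$.

  No Fubini theorem is available on a group that is not second countable, so the vector-valued
  integral is a limit of Riemann sums, and its value on \<open>K\<close> is computed by approximating \<open>f\<close> in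
  $L^1(G)$ by continuous functions, for which the Riemann sums converge uniformly.
\<close>

section \<open>Bounded inclusions between spaces closed under absolutely convergent series\<close>

text \<open>The hypothesis on products is an inclusion of sets without any norm estimate, so
  boundedness of the inclusion has to come from completeness, by a Baire category argument. The two
  spaces play unequal parts in it: the norm of $A_p(G)$ dominates the supremum norm, whereas
  elements of $S^1(G)$ are determined only up to null sets. The set $K E^{-1}$ consists of the t for
  which $t^{-1} s$ can lie in E for some s in K; it is compact because E is. Density of $S^1(G)$
  only gives elements near the bump function, not elements of compact support; the product
  hypothesis is what truncates them. For the bump function itself the constant is the integral of
  its reflection. Inversion need not preserve left Haar measure, so positivity is deduced from the
  non-empty interior of $K^{-1}$. For \<open>f\<close> the constant is never computed as an
  integral: it is the mean over K of the limit of the Riemann sums, and it stays close to the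
  constants of continuous functions near \<open>f\<close>.\<close>

text \<open>Completeness and the identification of limits with pointwise limits are both contained in the
  two axioms on series.\<close>

locale sum_normed =
  fixes X :: "('a \<Rightarrow> complex) set" and nrm :: "('a \<Rightarrow> complex) \<Rightarrow> real"
  assumes zero_in: "(\<lambda>_. 0) \<in> X"
    and nrm_zero: "nrm (\<lambda>_. 0) = 0"
    and scale_in: "x \<in> X \<Longrightarrow> (\<lambda>s. c * x s) \<in> X"
    and nrm_scale_le: "x \<in> X \<Longrightarrow> nrm (\<lambda>s. c * x s) \<le> cmod c * nrm x"
    and nrm_nonneg: "x \<in> X \<Longrightarrow> 0 \<le> nrm x"
    and series_in: "(\<And>n. a n \<in> X) \<Longrightarrow> summable (\<lambda>n. nrm (a n)) \<Longrightarrow> (\<And>s. (\<lambda>n. a n s) sums x s)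
      \<Longrightarrow> x \<in> X"
    and nrm_series_le: "(\<And>n. a n \<in> X) \<Longrightarrow> summable (\<lambda>n. nrm (a n)) \<Longrightarrow> (\<And>s. (\<lambda>n. a n s) sums x s)
      \<Longrightarrow> nrm x \<le> (\<Sum>n. nrm (a n))"
begin

text \<open>A sum of two elements is the series x, y, 0, 0, ..., so the series axioms already
  contain addition and the triangle inequality.\<close>

lemma
  assumes "x \<in> X" "y \<in> X"
  shows add_in: "(\<lambda>s. x s + y s) \<in> X"
    and nrm_triangle: "nrm (\<lambda>s. x s + y s) \<le> nrm x + nrm y"
proof -
  define a where "a n = (if n = 0 then x else if n = 1 then y else (\<lambda>_. 0))" for n :: nat
  have aX: "a n \<in> X" for n
    using assms zero_in by (simp add: a_def)
  have fin: "n \<notin> {0, 1} \<Longrightarrow> a n = (\<lambda>_. 0)" for n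
    by (simp add: a_def)
  have s1: "(\<lambda>n. nrm (a n)) sums (nrm x + nrm y)"
    using sums_finite[of "{0, 1}" "\<lambda>n. nrm (a n)"] fin by (simp add: nrm_zero a_def)
  have s2: "(\<lambda>n. a n s) sums (x s + y s)" for s
    using sums_finite[of "{0, 1}" "\<lambda>n. a n s"] fin by (simp add: a_def)
  show "(\<lambda>s. x s + y s) \<in> X"
    by (rule series_in[OF aX sums_summable[OF s1] s2])
  show "nrm (\<lambda>s. x s + y s) \<le> nrm x + nrm y"
    using nrm_series_le[OF aX sums_summable[OF s1] s2] sums_unique[OF s1] by simp
qed

lemma
  assumes "x \<in> X" "y \<in> X"
  shows diff_in: "(\<lambda>s. x s - y s) \<in> X"
    and nrm_triangle_diff: "nrm (\<lambda>s. x s - y s) \<le> nrm x + nrm y"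
  using add_in[OF assms(1) scale_in[OF assms(2), of "-1"]]
    nrm_triangle[OF assms(1) scale_in[OF assms(2), of "-1"]] nrm_scale_le[OF assms(2), of "-1"]
  by simp_all

lemma nrm_scale_real_le: "x \<in> X \<Longrightarrow> 0 \<le> c \<Longrightarrow> nrm (\<lambda>s. of_real c * x s) \<le> c * nrm x"
  using nrm_scale_le[of x "of_real c"] by simp

end

text \<open>Kept apart from \<open>sum_normed\<close> because it can fail in a Segal algebra, whose
  norm ignores null sets. It is asked only of the smaller space, where it makes the norm separating
  and norm convergence pointwise.\<close>

locale sup_dominated = sum_normed +
  assumes norm_le_nrm: "x \<in> X \<Longrightarrow> cmod (x s) \<le> nrm x"
begin

text \<open>Completeness in the form that the Baire argument uses: \<open>r n\<close> is a radius,
  and the balls about the \<open>u n\<close> are nested. The limit is the sum of the increments;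
  since the radii halve, the increments from \<open>k\<close> on add up to at most
  \<open>r k\<close>, so the limit stays in every ball.\<close>

lemma telescoping_limit:
  assumes X: "\<And>n. u n \<in> X" and r: "\<And>n. nrm (\<lambda>s. u (Suc n) s - u n s) \<le> r n / 2"
    and half: "\<And>n. r (Suc n) \<le> r n / 2"
  obtains x where "x \<in> X" "\<And>k. nrm (\<lambda>s. u k s - x s) \<le> r k"
proof -
  define d where "d n = (\<lambda>s. u (Suc n) s - u n s)" for n
  have dX: "d n \<in> X" for n
    unfolding d_def by (intro diff_in X)
  have rk: "r (k + j) \<le> r k / 2 ^ j" for k j
  proof (induction j)
    case (Suc j)
    have "r (k + Suc j) \<le> r (k + j) / 2" using half[of "k + j"] by simp
    also have "\<dots> \<le> r k / 2 ^ j / 2" using Suc by (rule divide_right_mono) simp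
    finally show ?case by (simp add: mult.commute)
  qed simp
  have dj: "nrm (d (k + j)) \<le> r k / 2 * (1 / 2) ^ j" for k j
  proof -
    have "nrm (d (k + j)) \<le> r (k + j) / 2" using r by (simp add: d_def)
    also have "\<dots> \<le> r k / 2 ^ j / 2" using rk by (rule divide_right_mono) simp
    finally show ?thesis by (simp add: power_one_over)
  qed
  have geo: "(\<lambda>j. r k / 2 * (1 / 2) ^ j) sums r k" for k
    using sums_mult[OF geometric_sums[of "1/2::real"], of "r k / 2"] by simp
  have dsum: "summable (\<lambda>j. nrm (d (k + j)))" for k
    by (rule summable_comparison_test[OF _ sums_summable[OF geo[of k]]])
       (use dj[of k] nrm_nonneg[OF dX] in auto)
  have dsums: "summable (\<lambda>j. d (k + j) s)" for k s
    by (rule summable_comparison_test[OF _ dsum[of k]]) (use norm_le_nrm[OF dX] in auto)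
  define x where "x s = u 0 s + (\<Sum>j. d j s)" for s
  have part: "(\<Sum>j<k. d j s) = u k s - u 0 s" for k s
    by (induction k) (simp_all add: d_def)
  have sums_x: "(\<lambda>j. d (k + j) s) sums (x s - u k s)" for k s
  proof -
    have "(\<Sum>j. d (k + j) s) = (\<Sum>j. d j s) - (\<Sum>j<k. d j s)"
      using suminf_minus_initial_segment[of "\<lambda>j. d j s" k] dsums[of 0 s] by (simp add: add.commute)
    then have "x s - u k s = (\<Sum>j. d (k + j) s)" by (simp add: x_def part)
    then show ?thesis
      using summable_sums[OF dsums[of k s]] by simp
  qed
  have xu: "(\<lambda>s. x s - u k s) \<in> X" for k
    by (rule series_in[OF dX dsum sums_x])
  have nxu: "nrm (\<lambda>s. x s - u k s) \<le> r k" for k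
  proof -
    have "nrm (\<lambda>s. x s - u k s) \<le> (\<Sum>j. nrm (d (k + j)))"
      by (rule nrm_series_le[OF dX dsum sums_x])
    also have "\<dots> \<le> (\<Sum>j. r k / 2 * (1 / 2) ^ j)"
      by (intro suminf_le dj dsum sums_summable[OF geo])
    also have "\<dots> = r k"
      by (rule sums_unique[OF geo, symmetric])
    finally show ?thesis .
  qed
  show thesis
  proof
    show "x \<in> X" using add_in[OF X[of 0] xu[of 0]] by simp
    show "nrm (\<lambda>s. u k s - x s) \<le> r k" for k
      using nrm_scale_le[OF xu[of k], of "-1"] nxu[of k] by simp
  qed
qed

text \<open>Baire category for the sets where \<open>M\<close> is at most \<open>k\<close>, which
  exhaust \<open>X\<close>. If none of them were dense in a ball, one could shrink balls so that the
  n-th step avoids the n-th set; the common point would then lie in none of them.\<close>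

lemma sublevel_dense_in_ball:
  fixes M :: "('a \<Rightarrow> complex) \<Rightarrow> real"
  shows "\<exists>k::nat. \<exists>r>0. \<exists>x0\<in>X. \<forall>x\<in>X. nrm (\<lambda>s. x s - x0 s) < r \<longrightarrow>
    (\<forall>e>0. \<exists>y\<in>X. M y \<le> real k \<and> nrm (\<lambda>s. x s - y s) < e)"
proof (rule ccontr)
  assume neg: "\<not> ?thesis"
  have neg': "\<exists>x\<in>X. nrm (\<lambda>s. x s - x0 s) < r \<and>
      (\<exists>e>0. \<forall>y\<in>X. M y \<le> real k \<longrightarrow> e \<le> nrm (\<lambda>s. x s - y s))" if "0 < r" "x0 \<in> X" for k r x0
    using neg that by (metis not_le)
  \<comment> \<open>Each \<open>f n\<close> is a pair of a centre and a radius.\<close>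
  have "\<exists>f. \<forall>n. (fst (f n) \<in> X \<and> 0 < snd (f n)) \<and>
    (nrm (\<lambda>s. fst (f (Suc n)) s - fst (f n) s) \<le> snd (f n) / 2 \<and> snd (f (Suc n)) \<le> snd (f n) / 2 \<and>
       (\<forall>y\<in>X. M y \<le> real n \<longrightarrow> snd (f (Suc n)) < nrm (\<lambda>s. fst (f (Suc n)) s - y s)))"
  proof (rule dependent_nat_choice)
    show "\<exists>z. fst z \<in> X \<and> 0 < (snd z :: real)"
      by (rule exI[of _ "(\<lambda>_. 0, 1)"]) (simp add: zero_in)
    fix z :: "('a \<Rightarrow> complex) \<times> real" and n :: nat
    assume z: "fst z \<in> X \<and> 0 < snd z"
    from neg'[of "snd z / 2" "fst z" n] z obtain x e where
      x: "x \<in> X" "nrm (\<lambda>s. x s - fst z s) < snd z / 2" "0 < e"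
        "\<forall>y\<in>X. M y \<le> real n \<longrightarrow> e \<le> nrm (\<lambda>s. x s - y s)"
      by auto
    show "\<exists>z'. (fst z' \<in> X \<and> 0 < snd z') \<and>
      (nrm (\<lambda>s. fst z' s - fst z s) \<le> snd z / 2 \<and> snd z' \<le> snd z / 2 \<and>
       (\<forall>y\<in>X. M y \<le> real n \<longrightarrow> snd z' < nrm (\<lambda>s. fst z' s - y s)))"
    \<comment> \<open>Half of \<open>e\<close> makes the avoidance strict, so that it survives the
      non-strict estimate for the limit; half of the old radius keeps the radii halving.\<close>
    proof (rule exI[of _ "(x, min e (snd z) / 2)"], simp, intro conjI ballI impI)
      show "min e (snd z) < nrm (\<lambda>s. x s - y s) * 2" if "y \<in> X" "M y \<le> real n" for y
      proof -
        have "e \<le> nrm (\<lambda>s. x s - y s)" using x(4) that by blast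
        then show ?thesis using x(3) by linarith
      qed
    qed (use x z in simp_all)
  qed
  then obtain f where "\<forall>n. (fst (f n) \<in> X \<and> 0 < snd (f n)) \<and>
    (nrm (\<lambda>s. fst (f (Suc n)) s - fst (f n) s) \<le> snd (f n) / 2 \<and> snd (f (Suc n)) \<le> snd (f n) / 2 \<and>
       (\<forall>y\<in>X. M y \<le> real n \<longrightarrow> snd (f (Suc n)) < nrm (\<lambda>s. fst (f (Suc n)) s - y s)))"
    by (rule exE)
  then have f: "\<And>n. fst (f n) \<in> X"
    "\<And>n. nrm (\<lambda>s. fst (f (Suc n)) s - fst (f n) s) \<le> snd (f n) / 2"
    "\<And>n. snd (f (Suc n)) \<le> snd (f n) / 2"
    "\<And>n y. y \<in> X \<Longrightarrow> M y \<le> real n \<Longrightarrow> snd (f (Suc n)) < nrm (\<lambda>s. fst (f (Suc n)) s - y s)"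
    by simp_all
  obtain x where x: "x \<in> X" "\<And>k. nrm (\<lambda>s. fst (f k) s - x s) \<le> snd (f k)"
    by (rule telescoping_limit[of "\<lambda>n. fst (f n)" "\<lambda>n. snd (f n)", OF f(1-3)]) blast
  obtain k where "M x \<le> real k"
    using real_arch_simple by blast
  from f(4)[OF x(1) this] x(2)[of "Suc k"] show False by simp
qed

text \<open>The closed graph of the inclusion is built in: limits in both spaces are pointwise.\<close>

theorem inclusion_bounded:
  assumes Y: "sum_normed Y M" and XY: "X \<subseteq> Y"
  obtains C where "\<And>x. x \<in> X \<Longrightarrow> M x \<le> C * nrm x"
proof -
  interpret Y: sum_normed Y M by (rule Y)
  obtain k r x0 where r: "0 < r" and x0: "x0 \<in> X" and
    dense: "\<And>x e. x \<in> X \<Longrightarrow> nrm (\<lambda>s. x s - x0 s) < r \<Longrightarrow> 0 < e \<Longrightarrow>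
      \<exists>y\<in>X. M y \<le> real k \<and> nrm (\<lambda>s. x s - y s) < e"
    using sublevel_dense_in_ball[of M] by blast
  \<comment> \<open>Subtracting an approximation of \<open>x0\<close> from one of
    \<open>z + x0\<close> moves the ball to the origin and doubles the bound on
    \<open>M\<close>.\<close>
  have dense0: "\<exists>y\<in>X. M y \<le> 2 * real k \<and> nrm (\<lambda>s. z s - y s) < e"
    if z: "z \<in> X" "nrm z < r" "0 < e" for z e
  proof -
    obtain y1 where y1: "y1 \<in> X" "M y1 \<le> real k" "nrm (\<lambda>s. (z s + x0 s) - y1 s) < e / 2"
      using dense[OF add_in[OF z(1) x0], of "e / 2"] z by auto
    obtain y2 where y2: "y2 \<in> X" "M y2 \<le> real k" "nrm (\<lambda>s. x0 s - y2 s) < e / 2"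
      using dense[OF x0, of "e / 2"] z r by (auto simp: nrm_zero)
    have "nrm (\<lambda>s. z s - (y1 s - y2 s)) = nrm (\<lambda>s. (z s + x0 s - y1 s) - (x0 s - y2 s))"
      by (simp add: algebra_simps)
    also have "\<dots> \<le> nrm (\<lambda>s. (z s + x0 s) - y1 s) + nrm (\<lambda>s. x0 s - y2 s)"
      by (intro nrm_triangle_diff diff_in add_in z x0 y1 y2)
    also have "\<dots> < e" using y1 y2 by simp
    finally have "nrm (\<lambda>s. z s - (y1 s - y2 s)) < e" .
    moreover have "M (\<lambda>s. y1 s - y2 s) \<le> M y1 + M y2"
      using y1 y2 XY by (intro Y.nrm_triangle_diff) auto
    ultimately show ?thesis
      using y1 y2 by (intro bexI[of _ "\<lambda>s. y1 s - y2 s"] conjI diff_in) auto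
  qed
  \<comment> \<open>\<open>dense0\<close> at scale \<open>c\<close>. The remainder lies in the ball
    of half the radius, so the step can be iterated.\<close>
  have step: "\<exists>y\<in>X. M y \<le> 2 * real k * c \<and> nrm (\<lambda>s. z s - y s) < r * c / 2"
    if z: "z \<in> X" "nrm z < r * c" and c: "0 < c" for z c
  proof -
    have "nrm (\<lambda>s. of_real (1 / c) * z s) \<le> 1 / c * nrm z"
      by (rule nrm_scale_real_le) (use z c in auto)
    also have "\<dots> < r" using z c by (simp add: field_simps)
    finally obtain y where y: "y \<in> X" "M y \<le> 2 * real k"
      "nrm (\<lambda>s. of_real (1 / c) * z s - y s) < r / 2"
      using dense0[OF scale_in[OF z(1)], of "of_real (1 / c)" "r / 2"] r by auto
    have eq: "(\<lambda>s. z s - of_real c * y s) = (\<lambda>s. of_real c * (of_real (1 / c) * z s - y s))"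
      using c by (simp add: right_diff_distrib)
    have "nrm (\<lambda>s. z s - of_real c * y s) \<le> c * nrm (\<lambda>s. of_real (1 / c) * z s - y s)"
      unfolding eq
      by (rule nrm_scale_real_le[OF diff_in[OF scale_in[OF z(1)] y(1)]]) (use c in simp)
    also have "\<dots> < c * (r / 2)" using y c by simp
    finally have 1: "nrm (\<lambda>s. z s - of_real c * y s) < r * c / 2" by (simp add: mult.commute)
    have "M (\<lambda>s. of_real c * y s) \<le> c * M y"
      by (rule Y.nrm_scale_real_le) (use c y XY in auto)
    also have "\<dots> \<le> 2 * real k * c" using y c by (simp add: field_simps)
    finally show ?thesis using 1 scale_in[OF y(1)] by blast
  qed
  \<comment> \<open>Successive approximation as in the open mapping theorem: the remainders
    \<open>u n\<close> shrink geometrically in \<open>X\<close>, the corrections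
    \<open>u n - u (Suc n)\<close> are geometrically bounded in \<open>Y\<close>, and the bounds add
    up to \<open>4 * k\<close>.\<close>
  have ball: "M z \<le> 4 * real k" if z: "z \<in> X" "nrm z < r" for z
  proof -
    have "\<exists>u. \<forall>n. (u n \<in> X \<and> nrm (u n) < r * (1 / 2) ^ n \<and> (n = 0 \<longrightarrow> u n = z)) \<and>
      M (\<lambda>s. u n s - u (Suc n) s) \<le> 2 * real k * (1 / 2) ^ n"
    proof (rule dependent_nat_choice)
      show "\<exists>x. x \<in> X \<and> nrm x < r * (1 / 2) ^ 0 \<and> ((0::nat) = 0 \<longrightarrow> x = z)"
        using z by auto
      fix x :: "'a \<Rightarrow> complex" and n :: nat
      assume x: "x \<in> X \<and> nrm x < r * (1 / 2) ^ n \<and> (n = 0 \<longrightarrow> x = z)"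
      then obtain y where y: "y \<in> X" "M y \<le> 2 * real k * (1 / 2) ^ n"
        "nrm (\<lambda>s. x s - y s) < r * (1 / 2) ^ n / 2"
        using step[of x "(1 / 2) ^ n"] by auto
      then show "\<exists>x'. (x' \<in> X \<and> nrm x' < r * (1 / 2) ^ Suc n \<and> (Suc n = 0 \<longrightarrow> x' = z)) \<and>
        M (\<lambda>s. x s - x' s) \<le> 2 * real k * (1 / 2) ^ n"
        using x by (intro exI[of _ "\<lambda>s. x s - y s"]) (auto intro: diff_in)
    qed
    then obtain u where "\<forall>n. (u n \<in> X \<and> nrm (u n) < r * (1 / 2) ^ n \<and> (n = 0 \<longrightarrow> u n = z)) \<and>
        M (\<lambda>s. u n s - u (Suc n) s) \<le> 2 * real k * (1 / 2) ^ n"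
      by (rule exE)
    then have u: "\<And>n. u n \<in> X" "\<And>n. nrm (u n) < r * (1 / 2) ^ n" "u 0 = z"
      "\<And>n. M (\<lambda>s. u n s - u (Suc n) s) \<le> 2 * real k * (1 / 2) ^ n"
      by simp_all
    define a where "a n = (\<lambda>s. u n s - u (Suc n) s)" for n
    have aY: "a n \<in> Y" for n
      unfolding a_def using diff_in[OF u(1) u(1)] XY by blast
    have geo: "(\<lambda>n. 2 * real k * (1 / 2) ^ n) sums (4 * real k)"
      using sums_mult[OF geometric_sums[of "1/2::real"], of "2 * real k"] by simp
    have sa: "summable (\<lambda>n. M (a n))"
      by (rule summable_comparison_test[OF _ sums_summable[OF geo]])
         (use u(4) Y.nrm_nonneg[OF aY] in \<open>auto simp: a_def\<close>)
    \<comment> \<open>Here domination of the supremum norm enters: the corrections sum pointwise to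
      \<open>z\<close>, which is what the series axiom of \<open>Y\<close> asks for.\<close>
    have "(\<lambda>n. u n s) \<longlonglongrightarrow> 0" for s
    proof (rule Lim_null_comparison)
      show "\<forall>\<^sub>F n in sequentially. cmod (u n s) \<le> r * (1 / 2) ^ n"
        using order.strict_trans1[OF norm_le_nrm[OF u(1)] u(2)] by (simp add: less_imp_le)
      show "(\<lambda>n. r * (1 / 2) ^ n) \<longlonglongrightarrow> 0"
        by (intro tendsto_mult_right_zero LIMSEQ_power_zero) simp
    qed
    then have "(\<lambda>n. a n s) sums z s" for s
      using telescope_sums'[of "\<lambda>n. u n s" 0] u(3) by (simp add: a_def)
    then have "M z \<le> (\<Sum>n. M (a n))"
      by (rule Y.nrm_series_le[OF aY sa])
    also have "\<dots> \<le> 4 * real k"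
      unfolding sums_unique[OF geo]
      by (intro suminf_le sa sums_summable[OF geo]) (use u(4) in \<open>auto simp: a_def\<close>)
    finally show ?thesis .
  qed
  show thesis
  proof
    fix x assume x: "x \<in> X"
    show "M x \<le> (8 * real k / r) * nrm x"
    proof (cases "nrm x = 0")
      case True
      then have "x = (\<lambda>_. 0)" using norm_le_nrm[OF x] by auto
      then show ?thesis by (simp add: Y.nrm_zero nrm_zero)
    next
      case False
      \<comment> \<open>The factor 2 puts the rescaled \<open>x\<close> strictly inside the ball,
        which turns the 4 of \<open>ball\<close> into 8.\<close>
      define c where "c = r / (2 * nrm x)"
      have pos: "0 < nrm x" using False nrm_nonneg[OF x] by simp
      then have c: "0 < c" using r by (simp add: c_def)
      have "nrm (\<lambda>s. of_real c * x s) \<le> c * nrm x"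
        by (rule nrm_scale_real_le) (use x c in auto)
      also have "\<dots> < r" using pos r by (simp add: c_def)
      finally have le: "M (\<lambda>s. of_real c * x s) \<le> 4 * real k"
        by (rule ball[OF scale_in[OF x]])
      have "M x = M (\<lambda>s. of_real (1 / c) * (of_real c * x s))"
        using c by simp
      also have "\<dots> \<le> 1 / c * M (\<lambda>s. of_real c * x s)"
        by (rule Y.nrm_scale_real_le) (use scale_in[OF x] XY c in auto)
      also have "\<dots> \<le> 1 / c * (4 * real k)"
        by (rule mult_left_mono) (use le c in auto)
      finally have "M x \<le> 1 / c * (4 * real k)" .
      then show ?thesis using pos by (simp add: c_def field_simps)
    qed
  qed
qed

end

section \<open>Figa-Talamanca--Herz algebras\<close>

text \<open>The majorant \<open>c\<close> makes the double family unconditionally summable, so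
  summing by rows and summing along the enumeration of pairs give the same value.\<close>

lemma sums_prod_decode:
  fixes f :: "nat \<Rightarrow> nat \<Rightarrow> 'b::banach"
  assumes bound: "\<And>n i. norm (f n i) \<le> c n i" and c: "\<And>n. c n sums C n" "summable C"
    and f: "\<And>n. f n sums g n" "g sums S"
  shows "(\<lambda>k. case_prod c (prod_decode k)) sums (\<Sum>n. C n)"
    and "(\<lambda>k. case_prod f (prod_decode k)) sums S"
proof -
  have c0: "0 \<le> c n i" for n i
    using norm_ge_zero bound by (rule order_trans)
  have C0: "0 \<le> C n" for n
    using sums_le[of "\<lambda>_. 0" "c n" 0 "C n"] c(1) c0 by simp
  have cs: "(c n has_sum C n) UNIV" for n
    using c(1) c0 by (rule sums_nonneg_imp_has_sum)
  have Cs: "(C has_sum (\<Sum>n. C n)) UNIV"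
    using summable_sums[OF c(2)] C0 by (rule sums_nonneg_imp_has_sum)
  have sc: "case_prod c summable_on (UNIV \<times> UNIV)"
    using cs has_sum_imp_summable[OF Cs] c0 by (intro summable_on_SigmaI) auto
  have hc: "(case_prod c has_sum (\<Sum>n. C n)) (UNIV \<times> UNIV)"
    by (rule has_sum_SigmaI[OF _ Cs sc]) (simp add: cs)
  have "(\<lambda>x. norm (case_prod f x)) summable_on (UNIV \<times> UNIV)"
    using sc by (rule summable_on_comparison_test) (use bound in auto)
  then have sf: "case_prod f summable_on (UNIV \<times> UNIV)"
    by (rule abs_summable_summable)
  have ns: "summable (\<lambda>i. norm (f n i))" for n
    by (rule summable_comparison_test[OF _ sums_summable[OF c(1)[of n]]]) (use bound in auto)
  have gC: "norm (g n) \<le> C n" for n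
    using norm_suminf_le[OF bound sums_summable[OF c(1)]] sums_unique[OF c(1)] sums_unique[OF f(1)]
    by simp
  have gS: "(g has_sum S) UNIV"
    by (rule norm_summable_imp_has_sum[OF _ f(2)])
      (rule summable_comparison_test[OF _ c(2)], use gC in auto)
  have hf: "(case_prod f has_sum S) (UNIV \<times> UNIV)"
    by (rule has_sum_SigmaI[OF _ gS sf]) (simp add: norm_summable_imp_has_sum[OF ns f(1)])
  show "(\<lambda>k. case_prod c (prod_decode k)) sums (\<Sum>n. C n)"
    using hc has_sum_reindex_bij_betw[OF bij_prod_decode, of "case_prod c"]
    by (intro has_sum_imp_sums) simp
  show "(\<lambda>k. case_prod f (prod_decode k)) sums S"
    using hf has_sum_reindex_bij_betw[OF bij_prod_decode, of "case_prod f"]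
    by (intro has_sum_imp_sums) simp
qed

text \<open>Young's inequality applied to both functions divided by their norms; if a norm is 0, the
  integrand vanishes almost everywhere.\<close>

lemma Hoelder_inequality:
  assumes p: "1 < p" and f: "f \<in> Lp_fun m (conj_exponent p)" and g: "g \<in> Lp_fun m p"
  shows "cmod (\<integral>t. f t * g t \<partial>m) \<le> Lp_norm m (conj_exponent p) f * Lp_norm m p g"
proof -
  define q where "q = conj_exponent p"
  have q: "1 < q" and pq: "1 / q + 1 / p = 1"
    using p conj_exponent[OF p] by (simp_all add: q_def conj_exponent_def field_simps)
  have zero: "AE t in m. h t = 0"
    if "h \<in> Lp_fun m r" "Lp_norm m r h = 0" for r and h :: "'a \<Rightarrow> complex"
  proof -
    have "(\<integral>s. norm (h s) powr r \<partial>m) = 0"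
      using that by (simp add: Lp_norm_def)
    then have "AE t in m. norm (h t) powr r = 0"
      using that by (subst integral_nonneg_eq_0_iff_AE[symmetric]) (auto simp: Lp_fun_def)
    then show ?thesis by simp
  qed
  define A where "A = Lp_norm m q f"
  define B where "B = Lp_norm m p g"
  show ?thesis
  proof (cases "A = 0 \<or> B = 0")
    case True
    then have "AE t in m. f t * g t = 0"
    proof
      assume "A = 0"
      from zero[OF f[folded q_def] this[unfolded A_def]] show ?thesis by eventually_elim simp
    next
      assume "B = 0"
      from zero[OF g this[unfolded B_def]] show ?thesis by eventually_elim simp
    qed
    then have "(\<integral>t. f t * g t \<partial>m) = 0" by (rule integral_eq_zero_AE)
    then show ?thesis by (simp add: Lp_norm_def)
  next
    case False
    then have A: "0 < A" and B: "0 < B"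
      by (auto simp: A_def B_def Lp_norm_def less_le)
    have Aq: "(\<integral>t. norm (f t) powr q \<partial>m) = A powr q"
      using q unfolding A_def Lp_norm_def by (simp add: powr_powr)
    have Bp: "(\<integral>t. norm (g t) powr p \<partial>m) = B powr p"
      using p unfolding B_def Lp_norm_def by (simp add: powr_powr)
    define h where "h t = A * B * (norm (f t) powr q / A powr q / q + norm (g t) powr p / B powr p / p)" for t
    have int: "integrable m (\<lambda>t. norm (f t) powr q)" "integrable m (\<lambda>t. norm (g t) powr p)"
      using f g by (auto simp: Lp_fun_def q_def)
    have inth: "integrable m h"
      unfolding h_def using int by simp
    have le: "norm (f t * g t) \<le> h t" for t
    proof -
      have "(norm (f t) / A) * (norm (g t) / B) \<le>
          (norm (f t) / A) powr q / q + (norm (g t) / B) powr p / p"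
        using Youngs_inequality[OF q p pq, of "norm (f t) / A" "norm (g t) / B"] A B by simp
      then have "A * B * ((norm (f t) / A) * (norm (g t) / B)) \<le> h t"
        unfolding h_def using A B by (intro mult_left_mono) (simp_all add: powr_divide)
      then show ?thesis using A B by (simp add: norm_mult)
    qed
    have "cmod (\<integral>t. f t * g t \<partial>m) \<le> (\<integral>t. norm (f t * g t) \<partial>m)"
      by (rule integral_norm_bound)
    also have "\<dots> \<le> (\<integral>t. h t \<partial>m)"
      by (rule integral_mono'[OF inth]) (use le order_trans[OF norm_ge_zero le] in auto)
    also have "\<dots> = A * B * (1 / q + 1 / p)"
      unfolding h_def using int A B by (simp add: Aq Bp)
    finally show ?thesis unfolding pq by (simp add: A_def B_def q_def)
  qed
qed

section \<open>Haar measure and left translation\<close>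

locale haar =
  fixes m :: "'a::{topological_group_add,t2_space} measure"
  assumes left_haar: "left_haar_measure m"
begin

lemma sets_m: "sets m = sets borel"
  using left_haar by (simp add: left_haar_measure_def)

lemma space_m [simp]: "space m = UNIV"
  using sets_eq_imp_space_eq[OF sets_m] by simp

lemma continuous_measurable_m: "continuous_on UNIV g \<Longrightarrow> g \<in> borel_measurable m"
  for g :: "'a \<Rightarrow> 'b::topological_space"
  using borel_measurable_continuous_onI measurable_cong_sets[OF sets_m refl] by blast

lemma measurable_translate: "(+) s \<in> measurable m m"
proof -
  have "(+) s \<in> borel_measurable m"
    by (rule continuous_measurable_m) (intro continuous_intros)
  then show ?thesis
    using measurable_cong_sets[OF refl sets_m] by blast
qed

lemma vimage_add: "(+) s -` A = (+) (- s) ` (A :: 'a set)"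
proof (intro set_eqI iffI)
  fix x assume "x \<in> (+) s -` A"
  then show "x \<in> (+) (- s) ` A"
    by (intro image_eqI[of _ _ "s + x"]) (auto simp flip: add.assoc)
qed (auto simp flip: add.assoc)

text \<open>Invariance is given for images of sets; as an equality of push-forward measures it
  applies directly to integrals.\<close>

lemma distr_translate: "distr m m ((+) s) = m"
proof (rule measure_eqI)
  fix A assume "A \<in> sets (distr m m ((+) s))"
  then have "A \<in> sets m" by simp
  then show "emeasure (distr m m ((+) s)) A = emeasure m A"
    using left_haar sets_m
    by (simp add: emeasure_distr measurable_translate vimage_add left_haar_measure_def)
qed simp

lemma
  fixes f :: "'a \<Rightarrow> 'b::{banach,second_countable_topology}"
  assumes "f \<in> borel_measurable m"
  shows integral_translate: "(\<integral>t. f (s + t) \<partial>m) = (\<integral>t. f t \<partial>m)"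
    and integrable_translate: "integrable m (\<lambda>t. f (s + t)) \<longleftrightarrow> integrable m f"
    and measurable_compose_translate: "(\<lambda>t. f (s + t)) \<in> borel_measurable m"
  using integral_distr[OF measurable_translate assms, of s]
    integrable_distr_eq[OF measurable_translate assms, of s]
    measurable_compose[OF measurable_translate assms, of s]
  by (simp_all add: distr_translate)

lemma
  assumes "g \<in> Lp_fun m r"
  shows Lp_fun_translate: "(\<lambda>t. g (s + t)) \<in> Lp_fun m r"
    and Lp_norm_translate: "Lp_norm m r (\<lambda>t. g (s + t)) = Lp_norm m r g"
  using assms integral_translate[of "\<lambda>t. norm (g t) powr r" s]
    integrable_translate[of "\<lambda>t. norm (g t) powr r" s] measurable_compose_translate[of g s]
  by (auto simp: Lp_fun_def Lp_norm_def)

text \<open>The inversion turns the second factor into a left translate of \<open>g\<close>, because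
  - (- t + s) = - s + t. Left invariance and Hoelder's inequality therefore bound the convolution at
  every point.\<close>

lemma conv_check_fun: "conv_fun m f (check_fun g) s = (\<integral>t. f t * g (- s + t) \<partial>m)"
  by (simp add: conv_fun_def check_fun_def minus_add)

lemma norm_conv_le:
  assumes "1 < p" "f \<in> Lp_fun m (conj_exponent p)" "g \<in> Lp_fun m p"
  shows "cmod (conv_fun m f (check_fun g) s) \<le> Lp_norm m (conj_exponent p) f * Lp_norm m p g"
  using Hoelder_inequality[OF assms(1,2) Lp_fun_translate[OF assms(3)], of "- s"]
  by (simp add: conv_check_fun Lp_norm_translate[OF assms(3)])

end

section \<open>The norm of the Figa-Talamanca--Herz algebra\<close>

lemma Lp_norm_nonneg: "0 \<le> Lp_norm m r f"
  by (simp add: Lp_norm_def)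

lemma Lp_norm_scale:
  assumes "0 < r"
  shows "Lp_norm m r (\<lambda>s. c * f s) = cmod c * Lp_norm m r f"
  using assms by (simp add: Lp_norm_def norm_mult powr_mult powr_powr)

lemma Lp_fun_scale: "f \<in> Lp_fun m r \<Longrightarrow> (\<lambda>s. c * f s) \<in> Lp_fun m r"
  by (auto simp: Lp_fun_def norm_mult powr_mult)

lemma Ap_norm_le:
  assumes "Ap_repr m p \<xi> \<eta> u"
  shows "Ap_norm m p u \<le> (\<Sum>i. Lp_norm m (conj_exponent p) (\<xi> i) * Lp_norm m p (\<eta> i))"
  unfolding Ap_norm_def
  by (rule cInf_lower) (use assms in \<open>auto simp: Ap_repr_def intro!: bdd_belowI2[of _ 0] bdd_belowI[of _ 0]
    suminf_nonneg Lp_norm_nonneg mult_nonneg_nonneg\<close>)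

lemma Ap_norm_nonneg:
  assumes "u \<in> Ap m p"
  shows "0 \<le> Ap_norm m p u"
  unfolding Ap_norm_def
  by (rule cInf_greatest) (use assms in \<open>auto simp: Ap_def Ap_repr_def intro!: suminf_nonneg Lp_norm_nonneg
    mult_nonneg_nonneg\<close>)

lemma Ap_repr_near_norm:
  assumes "u \<in> Ap m p" "Ap_norm m p u < b"
  obtains \<xi> \<eta> where "Ap_repr m p \<xi> \<eta> u"
    "(\<Sum>i. Lp_norm m (conj_exponent p) (\<xi> i) * Lp_norm m p (\<eta> i)) < b"
  using cInf_lessD[OF _ assms(2)[unfolded Ap_norm_def]] assms(1) by (auto simp: Ap_def)

lemma Ap_repr_zero: "0 < p \<Longrightarrow> Ap_repr m p (\<lambda>_ _. 0) (\<lambda>_ _. 0) (\<lambda>_. 0)"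
  by (simp add: Ap_repr_def Lp_fun_def Lp_norm_def conv_fun_def)

lemma Ap_repr_scale:
  assumes "Ap_repr m p \<xi> \<eta> u" "1 < p"
  shows "Ap_repr m p (\<lambda>i s. c * \<xi> i s) \<eta> (\<lambda>s. c * u s)"
  using assms
  by (auto simp: Ap_repr_def Lp_fun_scale Lp_norm_scale conj_exponent_def conv_fun_def mult.assoc
    intro!: summable_mult sums_mult)

context haar
begin

lemma norm_le_Ap_norm:
  assumes "1 < p" "u \<in> Ap m p"
  shows "cmod (u s) \<le> Ap_norm m p u"
  unfolding Ap_norm_def
proof (rule cInf_greatest)
  fix x assume "x \<in> {(\<Sum>i. Lp_norm m (conj_exponent p) (\<xi> i) * Lp_norm m p (\<eta> i)) | \<xi> \<eta>. Ap_repr m p \<xi> \<eta> u}"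
  then obtain \<xi> \<eta> where x: "x = (\<Sum>i. Lp_norm m (conj_exponent p) (\<xi> i) * Lp_norm m p (\<eta> i))"
    and r: "Ap_repr m p \<xi> \<eta> u" by auto
  have "u s = (\<Sum>i. conv_fun m (\<xi> i) (check_fun (\<eta> i)) s)"
    using r by (auto simp: Ap_repr_def intro: sums_unique)
  then show "cmod (u s) \<le> x"
    unfolding x using r assms(1) by (auto simp: Ap_repr_def intro!: norm_suminf_le norm_conv_le)
qed (use assms in \<open>auto simp: Ap_def\<close>)

text \<open>Each \<open>a n\<close> gets a representation whose cost exceeds its norm by less than e
  / 2^(n+1). Concatenating them along the enumeration of pairs represents \<open>x\<close> with
  total excess at most \<open>e\<close>.\<close>

lemma
  assumes p: "1 < p" and a: "\<And>n. a n \<in> Ap m p" and sum: "summable (\<lambda>n. Ap_norm m p (a n))"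
    and x: "\<And>s. (\<lambda>n. a n s) sums x s"
  shows Ap_series: "x \<in> Ap m p"
    and Ap_norm_series_le: "Ap_norm m p x \<le> (\<Sum>n. Ap_norm m p (a n))"
proof -
  let ?c = "\<lambda>\<xi> \<eta>. Lp_norm m (conj_exponent p) \<xi> * Lp_norm m p \<eta>"
  have main: "x \<in> Ap m p \<and> Ap_norm m p x \<le> (\<Sum>n. Ap_norm m p (a n)) + e" if e: "0 < e" for e
  proof -
    have "\<exists>\<xi> \<eta>. Ap_repr m p \<xi> \<eta> (a n) \<and> (\<Sum>i. ?c (\<xi> i) (\<eta> i)) < Ap_norm m p (a n) + e * (1 / 2) ^ Suc n" for n
      using Ap_repr_near_norm[OF a, of n "Ap_norm m p (a n) + e * (1 / 2) ^ Suc n"] e by fastforce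
    then obtain \<xi> \<eta> where r: "\<And>n. Ap_repr m p (\<xi> n) (\<eta> n) (a n)"
      and lt: "\<And>n. (\<Sum>i. ?c (\<xi> n i) (\<eta> n i)) < Ap_norm m p (a n) + e * (1 / 2) ^ Suc n"
      by metis
    have geo: "(\<lambda>n. e * (1 / 2) ^ Suc n) sums e"
      using sums_mult[OF power_half_series, of e] by simp
    have tot: "summable (\<lambda>n. Ap_norm m p (a n) + e * (1 / 2) ^ Suc n)"
      by (intro summable_add sum sums_summable[OF geo])
    define c where "c = (\<lambda>n i. ?c (\<xi> n i) (\<eta> n i))"
    define f where "f s = (\<lambda>n i. conv_fun m (\<xi> n i) (check_fun (\<eta> n i)) s)" for s
    have cs: "c n sums (\<Sum>i. c n i)" for n
      unfolding c_def using r[of n] by (intro summable_sums) (simp add: Ap_repr_def)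
    have Cle: "(\<Sum>i. c n i) \<le> Ap_norm m p (a n) + e * (1 / 2) ^ Suc n" for n
      using lt[of n] by (simp add: c_def)
    have C0: "0 \<le> (\<Sum>i. c n i)" for n
      using sums_summable[OF cs] by (rule suminf_nonneg) (simp add: c_def Lp_norm_nonneg)
    have C: "summable (\<lambda>n. \<Sum>i. c n i)"
      by (rule summable_comparison_test[OF _ tot])
        (use C0 Cle in \<open>simp del: power_Suc\<close>)
    have bound: "cmod (f s n i) \<le> c n i" for s n i
      using r p by (auto simp: f_def c_def Ap_repr_def intro: norm_conv_le)
    have fs: "f s n sums a n s" for s n
      using r by (auto simp: f_def Ap_repr_def)
    note D = sums_prod_decode[OF bound cs C fs x]
    have rx: "Ap_repr m p (\<lambda>k. case_prod \<xi> (prod_decode k)) (\<lambda>k. case_prod \<eta> (prod_decode k)) x"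
      unfolding Ap_repr_def
    proof (intro conjI allI)
      show "summable (\<lambda>k. ?c (case_prod \<xi> (prod_decode k)) (case_prod \<eta> (prod_decode k)))"
        using sums_summable[OF D(1)] by (simp add: c_def split_beta)
      show "(\<lambda>k. conv_fun m (case_prod \<xi> (prod_decode k)) (check_fun (case_prod \<eta> (prod_decode k))) s) sums x s" for s
        using D(2)[of s] by (simp add: f_def split_beta)
    qed (use r in \<open>auto simp: Ap_repr_def split_beta\<close>)
    have "Ap_norm m p x \<le> (\<Sum>n. \<Sum>i. c n i)"
      using Ap_norm_le[OF rx] sums_unique[OF D(1)] by (simp add: c_def split_beta)
    also have "\<dots> \<le> (\<Sum>n. Ap_norm m p (a n) + e * (1 / 2) ^ Suc n)"
      by (intro suminf_le C tot Cle)
    also have "\<dots> = (\<Sum>n. Ap_norm m p (a n)) + e"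
      using suminf_add[OF sum sums_summable[OF geo]] sums_unique[OF geo] by simp
    finally show ?thesis using rx by (auto simp: Ap_def)
  qed
  from main[of 1] show "x \<in> Ap m p" by simp
  show "Ap_norm m p x \<le> (\<Sum>n. Ap_norm m p (a n))"
    by (rule field_le_epsilon) (use main in blast)
qed

lemma closure_support_subset:
  fixes u :: "'a \<Rightarrow> complex"
  assumes "closed K"
  shows "closure {s. u s \<noteq> 0} \<subseteq> K \<longleftrightarrow> (\<forall>s. s \<notin> K \<longrightarrow> u s = 0)"
proof -
  have "closure {s. u s \<noteq> 0} \<subseteq> K \<longleftrightarrow> {s. u s \<noteq> 0} \<subseteq> K"
    by (meson assms closure_minimal closure_subset order_trans)
  then show ?thesis by auto
qed

text \<open>For closed \<open>K\<close> the support condition says that the function vanishes off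
  \<open>K\<close>, and this passes to pointwise sums.\<close>

lemma sup_dominated_Ap_supp:
  assumes p: "1 < p" and K: "closed K"
  shows "sup_dominated (Ap_supp m p K) (Ap_norm m p)"
proof -
  have supp: "u \<in> Ap_supp m p K \<longleftrightarrow> u \<in> Ap m p \<and> (\<forall>s. s \<notin> K \<longrightarrow> u s = 0)" for u
    by (simp add: Ap_supp_def closure_support_subset[OF K])
  have zero: "(\<lambda>_. 0) \<in> Ap m p"
    using Ap_repr_zero[of p m] p by (auto simp: Ap_def)
  have scale: "(\<lambda>s. c * u s) \<in> Ap m p" if "u \<in> Ap m p" for c u
    using that Ap_repr_scale[OF _ p] by (fastforce simp: Ap_def)
  show ?thesis
  proof (intro sup_dominated.intro sum_normed.intro sup_dominated_axioms.intro)
    show "Ap_norm m p (\<lambda>_. 0) = 0"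
      using Ap_norm_le[OF Ap_repr_zero[of p m]] Ap_norm_nonneg[OF zero] p
      by (simp add: Lp_norm_def)
    show "Ap_norm m p (\<lambda>s. c * u s) \<le> cmod c * Ap_norm m p u" if "u \<in> Ap_supp m p K" for u c
    proof -
      have u: "u \<in> Ap m p" using that by (simp add: supp)
      have "Ap_norm m p (\<lambda>s. c * u s) \<le> cmod c * b" if b: "Ap_norm m p u < b" for b
      proof -
        obtain \<xi> \<eta> where r: "Ap_repr m p \<xi> \<eta> u"
          and lt: "(\<Sum>i. Lp_norm m (conj_exponent p) (\<xi> i) * Lp_norm m p (\<eta> i)) < b"
          using Ap_repr_near_norm[OF u b] by blast
        have "Ap_norm m p (\<lambda>s. c * u s) \<le>
            (\<Sum>i. cmod c * (Lp_norm m (conj_exponent p) (\<xi> i) * Lp_norm m p (\<eta> i)))"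
          using Ap_norm_le[OF Ap_repr_scale[OF r p, of c]] p
          by (simp add: Lp_norm_scale conj_exponent_def mult.assoc)
        also have "\<dots> = cmod c * (\<Sum>i. Lp_norm m (conj_exponent p) (\<xi> i) * Lp_norm m p (\<eta> i))"
          using r by (intro suminf_mult) (simp add: Ap_repr_def)
        also have "\<dots> \<le> cmod c * b"
          using lt by (intro mult_left_mono) auto
        finally show ?thesis .
      qed
      note le = this
      show ?thesis
      proof (rule field_le_epsilon)
        fix e :: real assume e: "0 < e"
        have c: "0 < cmod c + 1" by (simp add: add_nonneg_pos)
        \<comment> \<open>The 1 in the denominator covers c = 0 without a case distinction.\<close>
        have "Ap_norm m p (\<lambda>s. c * u s) \<le> cmod c * (Ap_norm m p u + e / (cmod c + 1))"
          by (rule le) (use e c in simp)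
        also have "\<dots> = cmod c * Ap_norm m p u + e * (cmod c / (cmod c + 1))"
          by (simp add: distrib_left)
        also have "\<dots> \<le> cmod c * Ap_norm m p u + e * 1"
          using e c by (intro add_left_mono mult_left_mono) (auto simp: divide_le_eq_1_pos)
        finally show "Ap_norm m p (\<lambda>s. c * u s) \<le> cmod c * Ap_norm m p u + e" by simp
      qed
    qed
    fix a :: "nat \<Rightarrow> 'a \<Rightarrow> complex" and x
    assume a: "\<And>n. a n \<in> Ap_supp m p K" "summable (\<lambda>n. Ap_norm m p (a n))" "\<And>s. (\<lambda>n. a n s) sums x s"
    have "x s = 0" if "s \<notin> K" for s
      using a(3)[of s] a(1) that sums_unique2[OF a(3)[of s], of 0] by (simp add: supp)
    then show "x \<in> Ap_supp m p K" "Ap_norm m p x \<le> (\<Sum>n. Ap_norm m p (a n))"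
      using Ap_series[OF p _ a(2,3)] Ap_norm_series_le[OF p _ a(2,3)] a(1) by (auto simp: supp)
  qed (use zero scale Ap_norm_nonneg norm_le_Ap_norm[OF p] in \<open>auto simp: supp\<close>)
qed

end

section \<open>Segal algebras\<close>

context segal_algebra
begin

lemma sum_mem: "finite I \<Longrightarrow> (\<And>i. i \<in> I \<Longrightarrow> f i \<in> S) \<Longrightarrow> (\<lambda>s. \<Sum>i\<in>I. f i s) \<in> S"
  by (induction I rule: finite_induct) (simp_all add: zero_mem add_mem)

lemma norm_zero_fun: "N (\<lambda>_. 0) = 0"
  using norm_eq_0_iff[OF zero_mem] by simp

lemma norm_sum_le:
  "finite I \<Longrightarrow> (\<And>i. i \<in> I \<Longrightarrow> f i \<in> S) \<Longrightarrow> N (\<lambda>s. \<Sum>i\<in>I. f i s) \<le> (\<Sum>i\<in>I. N (f i))"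
proof (induction I rule: finite_induct)
  case (insert i I)
  then have "N (\<lambda>s. f i s + (\<Sum>j\<in>I. f j s)) \<le> N (f i) + N (\<lambda>s. \<Sum>j\<in>I. f j s)"
    by (intro norm_triangle sum_mem) auto
  with insert show ?case by simp
qed (simp add: norm_zero_fun)

lemma diff_mem: "f \<in> S \<Longrightarrow> g \<in> S \<Longrightarrow> (\<lambda>s. f s - g s) \<in> S"
  using add_mem[OF _ scale_mem[of g "-1"], of f] by simp

lemma norm_diff_commute: "f \<in> S \<Longrightarrow> g \<in> S \<Longrightarrow> N (\<lambda>s. f s - g s) = N (\<lambda>s. g s - f s)"
  using norm_scale[OF diff_mem, of f g "-1"] by simp

lemma norm_diff_triangle:
  assumes "f \<in> S" "g \<in> S" "h \<in> S"
  shows "N (\<lambda>s. f s - h s) \<le> N (\<lambda>s. f s - g s) + N (\<lambda>s. g s - h s)"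
  using norm_triangle[OF diff_mem diff_mem, of f g g h] assms by simp

lemma norm_cong_AE:
  assumes "f \<in> S" "g \<in> S" "AE s in m. f s = g s"
  shows "N f = N g"
proof -
  have "N (\<lambda>s. f s - g s) = 0"
    using norm_eq_0_iff[OF diff_mem[OF assms(1,2)]] assms(3) by simp
  then show ?thesis
    using norm_triangle[OF diff_mem[OF assms(1,2)] assms(2)]
      norm_triangle[OF diff_mem[OF assms(2,1)] assms(1)] norm_diff_commute[OF assms(1,2)]
    by simp
qed

lemma L1_le_norm:
  obtains C where "0 < C" "\<And>f. f \<in> S \<Longrightarrow> (\<integral>s. norm (f s) \<partial>m) \<le> C * N f"
proof -
  obtain C where C: "\<And>f. f \<in> S \<Longrightarrow> (\<integral>s. norm (f s) \<partial>m) \<le> C * N f"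
    using inclusion_bounded by blast
  have "(\<integral>s. norm (f s) \<partial>m) \<le> (\<bar>C\<bar> + 1) * N f" if "f \<in> S" for f
  proof -
    have "C * N f \<le> (\<bar>C\<bar> + 1) * N f"
      by (rule mult_right_mono) (use norm_nonneg[OF that] in auto)
    then show ?thesis using C[OF that] by simp
  qed
  then show thesis by (intro that[of "\<bar>C\<bar> + 1"]) auto
qed

text \<open>The abstract limit \<open>f\<close> is also a limit in $L^1(G)$, so a subsequence
  converges to it almost everywhere and \<open>f\<close> agrees with \<open>x\<close> almost
  everywhere. This is how limits in \<open>N\<close> become pointwise limits.\<close>

lemma norm_limit_eq_pointwise_limit:
  assumes P: "\<And>n. P n \<in> S" and f: "f \<in> S" and lim: "(\<lambda>n. N (\<lambda>s. P n s - f s)) \<longlonglongrightarrow> 0"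
    and x: "\<And>s. (\<lambda>n. P n s) \<longlonglongrightarrow> x s"
  shows "x \<in> S" and "(\<lambda>n. N (\<lambda>s. P n s - x s)) \<longlonglongrightarrow> 0"
proof -
  obtain C where C: "0 < C" "\<And>f. f \<in> S \<Longrightarrow> (\<integral>s. norm (f s) \<partial>m) \<le> C * N f"
    by (rule L1_le_norm) blast
  have "(\<lambda>n. \<integral>s. norm (P n s - f s) \<partial>m) \<longlonglongrightarrow> 0"
  proof (rule Lim_null_comparison)
    show "\<forall>\<^sub>F n in sequentially. norm (\<integral>s. norm (P n s - f s) \<partial>m) \<le> C * N (\<lambda>s. P n s - f s)"
      using C(2)[OF diff_mem[OF P f]] by simp
    show "(\<lambda>n. C * N (\<lambda>s. P n s - f s)) \<longlonglongrightarrow> 0"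
      using tendsto_mult_right_zero[OF lim] .
  qed
  from tendsto_L1_AE_subseq[OF subset_L1[OF diff_mem[OF P f]] this]
  obtain r where r: "strict_mono r" "AE s in m. (\<lambda>n. P (r n) s - f s) \<longlonglongrightarrow> 0" by blast
  have ae: "AE s in m. f s = x s"
    using r(2)
  proof eventually_elim
    case (elim s)
    from elim have "(\<lambda>n. P (r n) s) \<longlonglongrightarrow> f s" by (rule LIM_zero_cancel)
    moreover have "(\<lambda>n. P (r n) s) \<longlonglongrightarrow> x s"
      using LIMSEQ_subseq_LIMSEQ[OF x r(1)] by (simp add: o_def)
    ultimately show ?case by (rule LIMSEQ_unique)
  qed
  have "x \<in> borel_measurable m"
    by (rule borel_measurable_LIMSEQ_metric[of P]) (use x subset_L1[OF P] in auto)
  then show xS: "x \<in> S"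
    using AE_closed[OF f _ ae] by simp
  have "N (\<lambda>s. P n s - x s) = N (\<lambda>s. P n s - f s)" for n
    by (rule norm_cong_AE) (use ae in \<open>auto intro: diff_mem P f xS\<close>)
  then show "(\<lambda>n. N (\<lambda>s. P n s - x s)) \<longlonglongrightarrow> 0"
    using lim by simp
qed

text \<open>The partial sums are Cauchy; their limit in \<open>S\<close> may be replaced by the
  pointwise sum \<open>x\<close>.\<close>

lemma
  assumes a: "\<And>n. a n \<in> S" "summable (\<lambda>n. N (a n))" and x: "\<And>s. (\<lambda>n. a n s) sums x s"
  shows series_mem: "x \<in> S" and norm_series_le: "N x \<le> (\<Sum>n. N (a n))"
proof -
  define P where "P n = (\<lambda>s. \<Sum>i<n. a i s)" for n :: nat
  have PS: "P n \<in> S" for n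
    unfolding P_def by (intro sum_mem a) simp
  have Pdiff: "N (\<lambda>s. P k s - P n s) \<le> (\<Sum>i=n..<k. N (a i))" if "n \<le> k" for n k
  proof -
    have "P k s - P n s = (\<Sum>i=n..<k. a i s)" for s
      unfolding P_def using sum_diff_nat_ivl[of 0 n k "\<lambda>i. a i s"] that by (simp add: atLeast0LessThan)
    then show ?thesis using norm_sum_le[of "{n..<k}" a] a(1) by simp
  qed
  have "\<exists>f\<in>S. (\<lambda>n. N (\<lambda>s. P n s - f s)) \<longlonglongrightarrow> 0"
  proof (rule complete[OF PS])
    fix e :: real assume "0 < e"
    with a(2) obtain M where M: "\<And>n k. M \<le> n \<Longrightarrow> norm (\<Sum>i=n..<k. N (a i)) < e"
      unfolding summable_Cauchy by blast
    have "N (\<lambda>s. P k s - P n s) < e" if "M \<le> n" "n \<le> k" for n k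
      using Pdiff[OF that(2)] M[OF that(1), of k] by simp
    then show "\<exists>M. \<forall>k\<ge>M. \<forall>n\<ge>M. N (\<lambda>s. P k s - P n s) < e"
      using norm_diff_commute[OF PS PS] by (metis nle_le)
  qed
  then obtain f where f: "f \<in> S" "(\<lambda>n. N (\<lambda>s. P n s - f s)) \<longlonglongrightarrow> 0" by blast
  have Px: "(\<lambda>n. P n s) \<longlonglongrightarrow> x s" for s
    using x[of s] by (simp add: sums_def P_def)
  show xS: "x \<in> S" by (rule norm_limit_eq_pointwise_limit[OF PS f Px])
  have lim: "(\<lambda>n. N (\<lambda>s. P n s - x s)) \<longlonglongrightarrow> 0"
    by (rule norm_limit_eq_pointwise_limit[OF PS f Px])
  have le: "N x \<le> N (\<lambda>s. P n s - x s) + (\<Sum>n. N (a n))" for n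
  proof -
    have "N x \<le> N (\<lambda>s. x s - P n s) + N (P n)"
      using norm_triangle[OF diff_mem[OF xS PS] PS, of n n] by simp
    also have "N (P n) \<le> (\<Sum>i<n. N (a i))"
      unfolding P_def by (intro norm_sum_le a) simp
    also have "\<dots> \<le> (\<Sum>n. N (a n))"
      by (rule sum_le_suminf[OF a(2)]) (use a in \<open>auto intro: norm_nonneg\<close>)
    finally show ?thesis using norm_diff_commute[OF xS PS] by simp
  qed
  have "(\<lambda>n. N (\<lambda>s. P n s - x s) + (\<Sum>n. N (a n))) \<longlonglongrightarrow> 0 + (\<Sum>n. N (a n))"
    by (intro tendsto_add lim tendsto_const)
  then show "N x \<le> (\<Sum>n. N (a n))"
    using LIMSEQ_le_const[of _ "\<Sum>n. N (a n)" "N x"] le by auto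
qed

text \<open>Lets \<open>S\<close> serve as the larger space \<open>Y\<close> in
  \<open>inclusion_bounded\<close>.\<close>

lemma sum_normed: "sum_normed S N"
  by (rule sum_normed.intro)
    (auto simp: zero_mem norm_zero_fun norm_scale norm_nonneg intro: scale_mem series_mem norm_series_le)

end

section \<open>Continuous functions of compact support\<close>

definition Cc :: "('a::topological_space \<Rightarrow> complex) set" where
  "Cc = {f. continuous_on UNIV f \<and> (\<exists>D. compact D \<and> (\<forall>s. s \<notin> D \<longrightarrow> f s = 0))}"

lemma Cc_add: "f \<in> Cc \<Longrightarrow> g \<in> Cc \<Longrightarrow> (\<lambda>s. f s + g s) \<in> Cc"
  unfolding Cc_def
proof safe
  fix D E assume *: "compact D" "\<forall>s. s \<notin> D \<longrightarrow> f s = 0" "compact E" "\<forall>s. s \<notin> E \<longrightarrow> g s = 0"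
  show "\<exists>D. compact D \<and> (\<forall>s. s \<notin> D \<longrightarrow> f s + g s = 0)"
    by (rule exI[of _ "D \<union> E"]) (use * in auto)
qed (intro continuous_intros)

lemma locally_compact_nbhd:
  fixes C :: "'a::topological_space set"
  assumes "locally_compact_space (euclidean :: 'a topology)" "compact C"
  obtains U D where "open U" "compact D" "C \<subseteq> U" "U \<subseteq> D"
proof -
  have "\<forall>x::'a. \<exists>U. open U \<and> (\<exists>D. compact D \<and> x \<in> U \<and> U \<subseteq> D)"
    using assms(1) by (simp add: locally_compact_space_def)
  from choice[OF this] obtain U where U: "\<forall>x::'a. open (U x) \<and> (\<exists>D. compact D \<and> x \<in> U x \<and> U x \<subseteq> D)"
    by (rule exE)
  then have "\<forall>x. \<exists>D. compact D \<and> x \<in> U x \<and> U x \<subseteq> D" by simp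
  from choice[OF this] obtain D where "\<forall>x. compact (D x) \<and> x \<in> U x \<and> U x \<subseteq> D x"
    by (rule exE)
  with U have UD: "\<And>x. open (U x)" "\<And>x. compact (D x)" "\<And>x. x \<in> U x" "\<And>x. U x \<subseteq> D x"
    by simp_all
  obtain T where T: "T \<subseteq> C" "finite T" "C \<subseteq> (\<Union>x\<in>T. U x)"
    by (rule compactE_image[OF assms(2), of C U]) (use UD in auto)
  show thesis
    by (rule that[of "\<Union>x\<in>T. U x" "\<Union>x\<in>T. D x"]) (use UD T in \<open>auto intro!: compact_UN bexI subsetD[OF UD(4)]\<close>)
qed

text \<open>\<open>U\<close> is first cut down to a neighbourhood \<open>V\<close> of
  \<open>C\<close> inside a compact set, so that vanishing off U \<inter> V forces compact
  support.\<close>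

lemma Urysohn_compact:
  fixes C :: "'a::t2_space set"
  assumes lc: "locally_compact_space (euclidean :: 'a topology)" and "compact C" "open U" "C \<subseteq> U"
  obtains f :: "'a \<Rightarrow> real" where "(\<lambda>s. complex_of_real (f s)) \<in> Cc" "\<And>s. 0 \<le> f s" "\<And>s. f s \<le> 1"
    "\<And>s. s \<in> C \<Longrightarrow> f s = 1" "\<And>s. s \<notin> U \<Longrightarrow> f s = 0"
proof -
  obtain V D where V: "open V" "compact D" "C \<subseteq> V" "V \<subseteq> D"
    by (rule locally_compact_nbhd[OF lc assms(2)])
  have "Hausdorff_space (euclidean :: 'a topology)"
    by (simp add: Hausdorff_space_def disjnt_def) (metis hausdorff)
  then have "completely_regular_space (euclidean :: 'a topology)"
    using locally_compact_regular_imp_completely_regular_space[OF lc] by blast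
  then obtain f where f: "continuous_map euclidean (top_of_set {0..1::real}) f"
    "f ` (- (U \<inter> V)) \<subseteq> {0}" "f ` C \<subseteq> {1}"
    by (rule Urysohn_completely_regular_compact_closed[of 0 1 euclidean C "- (U \<inter> V)", rotated])
      (use assms V in \<open>auto simp: disjnt_def\<close>)
  have cf: "continuous_on UNIV f" and rg: "\<And>s. f s \<in> {0..1}"
    using f(1) by (auto simp: continuous_map_in_subtopology)
  show thesis
  proof (rule that)
    show "(\<lambda>s. complex_of_real (f s)) \<in> Cc"
      unfolding Cc_def using cf f(2) V by (auto intro!: continuous_intros exI[of _ D])
  qed (use f rg in auto)
qed

text \<open>The tube lemma gives a neighbourhood that works for all \<open>s\<close> in the compact
  set \<open>D\<close>. Making it symmetric settles the points outside \<open>D\<close> that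
  \<open>v\<close> moves into \<open>D\<close>: there - v is applied to v + s.\<close>

lemma Cc_uniformly_continuous:
  fixes f :: "'a::{topological_group_add,t2_space} \<Rightarrow> complex"
  assumes "f \<in> Cc" "0 < e"
  obtains V where "open V" "0 \<in> V" "\<And>v s. v \<in> V \<Longrightarrow> norm (f (v + s) - f s) < e"
proof -
  obtain D where f: "continuous_on UNIV f" and D: "compact D" "\<And>s. s \<notin> D \<Longrightarrow> f s = 0"
    using assms(1) by (auto simp: Cc_def)
  define W where "W = {(v, s). norm (f (v + s) - f s) < e}"
  have cont: "continuous_on UNIV (\<lambda>x::'a \<times> 'a. f (fst x + snd x) - f (snd x))"
    by (intro continuous_on_diff continuous_on_compose2[OF f] continuous_intros) auto
  have "open W"
    unfolding W_def split_beta
    by (intro open_Collect_less continuous_on_norm[OF cont] continuous_on_const)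
  then obtain V where V: "0 \<in> V" "open V" "V \<times> D \<subseteq> W"
    using Elementary_Topology.tube_lemma[OF D(1), of W 0] assms(2) by (force simp: W_def)
  have "open (uminus -` V)"
    by (rule open_vimage[OF V(2)]) (intro continuous_intros)
  show thesis
  proof (rule that)
    show "open (V \<inter> uminus -` V)" using \<open>open (uminus -` V)\<close> V by auto
    show "0 \<in> V \<inter> uminus -` V" using V by auto
    fix v s assume v: "v \<in> V \<inter> uminus -` V"
    show "norm (f (v + s) - f s) < e"
    proof (cases "s \<in> D")
      case True
      then show ?thesis using v V by (auto simp: W_def)
    next
      case False
      show ?thesis
      proof (cases "v + s \<in> D")
        case True
        then have "(- v, v + s) \<in> W" using v V by auto
        then have "norm (f (- v + (v + s)) - f (v + s)) < e" unfolding W_def by simp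
        moreover have "- v + (v + s) = s" by (simp flip: add.assoc)
        ultimately show ?thesis by (simp add: norm_minus_commute)
      next
        case F: False
        then show ?thesis using D(2)[OF False] D(2)[OF F] assms(2) by simp
      qed
    qed
  qed
qed

section \<open>Regularity of Haar measure and density of continuous functions in $L^1(G)$\<close>

locale lc_haar = haar m for m :: "'a::{topological_group_add,t2_space} measure" +
  assumes lc: "locally_compact_space (euclidean :: 'a topology)"
begin

lemma compact_sets: "compact C \<Longrightarrow> C \<in> sets m"
  by (simp add: sets_m borel_closed compact_imp_closed)

lemma compact_finite: "compact C \<Longrightarrow> emeasure m C < \<infinity>"
  using left_haar by (simp add: left_haar_measure_def)

lemma emeasure_translate: "A \<in> sets m \<Longrightarrow> emeasure m ((+) t ` A) = emeasure m A"
  using left_haar by (simp add: left_haar_measure_def)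

lemma open_translate: "open U \<Longrightarrow> open ((+) t ` (U :: 'a set))"
  using open_vimage[of U "(+) (- t)"] vimage_add[of "- t" U]
    continuous_on_add[OF continuous_on_const continuous_on_id, of UNIV "- t"] by simp

text \<open>Finitely many translates of \<open>U\<close> cover any compact set. If \<open>U\<close>
  were null, all compact sets would be null, and by inner regularity so would the whole
  group.\<close>

lemma emeasure_open_pos:
  assumes "open U" "U \<noteq> {}"
  shows "0 < emeasure m U"
proof (rule ccontr)
  assume "\<not> 0 < emeasure m U"
  then have 0: "emeasure m U = 0" by (simp add: zero_less_iff_neq_zero)
  have U: "U \<in> sets m" using assms by (simp add: sets_m)
  obtain u where u: "u \<in> U" using assms by blast
  have null: "emeasure m C = 0" if C: "compact C" for C
  proof -
    have tr: "(+) (t - u) ` U \<in> sets m" for t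
      using open_translate[OF assms(1)] by (simp add: sets_m)
    obtain T where T: "finite T" "C \<subseteq> (\<Union>t\<in>T. (+) (t - u) ` U)"
    proof (rule compactE_image[OF C, of C "\<lambda>t. (+) (t - u) ` U"])
      show "C \<subseteq> (\<Union>t\<in>C. (+) (t - u) ` U)"
        using u by (auto intro!: bexI image_eqI[of _ _ u])
    qed (use open_translate[OF assms(1)] in auto)
    have "emeasure m C \<le> emeasure m (\<Union>t\<in>T. (+) (t - u) ` U)"
      using T tr by (intro emeasure_mono) auto
    also have "\<dots> \<le> (\<Sum>t\<in>T. emeasure m ((+) (t - u) ` U))"
      using T tr by (intro emeasure_subadditive_finite) auto
    also have "\<dots> = 0" using emeasure_translate[OF U] 0 by simp
    finally show ?thesis by simp
  qed
  have "emeasure m UNIV = (SUP C\<in>{C. compact C \<and> C \<subseteq> UNIV}. emeasure m C)"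
    using left_haar unfolding left_haar_measure_def by blast
  also have "\<dots> \<le> 0"
    by (rule SUP_least) (simp add: null)
  finally have "emeasure m UNIV \<le> 0" .
  then show False using left_haar by (auto simp: left_haar_measure_def)
qed

lemma integrable_bounded_compact:
  fixes f :: "'a \<Rightarrow> 'b::{banach,second_countable_topology}"
  assumes "f \<in> borel_measurable m" "\<And>s. norm (f s) \<le> B" "compact D" "\<And>s. s \<notin> D \<Longrightarrow> f s = 0"
  shows "integrable m f"
proof (rule Bochner_Integration.integrable_bound)
  show "integrable m (\<lambda>s. B * indicator D s :: real)"
    using compact_sets[OF assms(3)] compact_finite[OF assms(3)] by simp
  show "AE s in m. norm (f s) \<le> norm (B * indicator D s :: real)"
    using assms(2,4) order_trans[OF assms(2) abs_ge_self]
    by (intro AE_I2) (auto simp: indicator_def)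
qed (rule assms(1))

lemma Cc_integrable: "f \<in> Cc \<Longrightarrow> integrable m f"
proof -
  assume f: "f \<in> Cc"
  then obtain D where D: "continuous_on UNIV f" "compact D" "\<And>s. s \<notin> D \<Longrightarrow> f s = 0"
    by (auto simp: Cc_def)
  have "compact (f ` D)"
    using D by (intro compact_continuous_image continuous_on_subset[OF D(1)]) auto
  then obtain B where "\<forall>x\<in>f ` D. norm x \<le> B"
    using compact_imp_bounded bounded_iff by metis
  then have "norm (f s) \<le> max B 0" for s
    using D(3)[of s] by (cases "s \<in> D") (auto simp: le_max_iff_disj)
  then show ?thesis
    using continuous_measurable_m[OF D(1)] D by (intro integrable_bounded_compact)
qed

text \<open>Inner regularity is available for open sets, so the compact set is chosen in the open
  set \<open>U\<close> around \<open>A\<close> and not in \<open>A\<close>. A function that is 1 on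
  \<open>C\<close> and 0 off \<open>U\<close> differs from the indicator of \<open>A\<close> only on
  U - A and U - C.\<close>

lemma indicator_Cc_approx:
  assumes A: "A \<in> sets m" "emeasure m A < \<infinity>" and e: "0 < e"
  obtains g :: "'a \<Rightarrow> real" where "(\<lambda>s. complex_of_real (g s)) \<in> Cc"
    "(\<integral>s. \<bar>indicator A s - g s\<bar> \<partial>m) < e"
proof -
  have "emeasure m A = (INF U\<in>{U. open U \<and> A \<subseteq> U}. emeasure m U)"
    using left_haar A sets_m unfolding left_haar_measure_def by blast
  from INF_approx_ennreal[OF _ this, of "e / 2"] A(2) e obtain U where
    U: "open U" "A \<subseteq> U" "emeasure m U < emeasure m A + ennreal (e / 2)"
    by (auto simp: less_top)
  have Ufin: "emeasure m U < \<infinity>"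
    using U(3) A(2) by (metis ennreal_add_less_top ennreal_less_top infinity_ennreal_def order.strict_trans)
  have "emeasure m U = (SUP C\<in>{C. compact C \<and> C \<subseteq> U}. emeasure m C)"
    using left_haar U unfolding left_haar_measure_def by blast
  from SUP_approx_ennreal[OF _ _ this, of "e / 2"] Ufin e obtain C where
    C: "compact C" "C \<subseteq> U" "emeasure m U < emeasure m C + ennreal (e / 2)"
    by (auto simp: less_top)
  have Us: "U \<in> sets m" using U by (simp add: sets_m)
  note Cs = compact_sets[OF C(1)]
  have emU: "emeasure m U = ennreal (measure m U)" and emA: "emeasure m A = ennreal (measure m A)"
    and emC: "emeasure m C = ennreal (measure m C)"
    using Ufin A compact_finite[OF C(1)] by (auto simp: emeasure_eq_ennreal_measure)
  have "measure m U < measure m A + e / 2" "measure m U < measure m C + e / 2"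
    using U(3) C(3) e unfolding emU emA emC by (simp_all flip: ennreal_plus add: ennreal_less_iff)
  then have small: "measure m (U - A) + measure m (U - C) < e"
    using measure_Diff[of m U A] measure_Diff[of m U C] Ufin Us A Cs U C by simp
  obtain g where g: "(\<lambda>s. complex_of_real (g s)) \<in> Cc" "\<And>s. 0 \<le> g s" "\<And>s. g s \<le> 1"
    "\<And>s. s \<in> C \<Longrightarrow> g s = 1" "\<And>s. s \<notin> U \<Longrightarrow> g s = 0"
    by (rule Urysohn_compact[OF lc C(1) U(1) C(2)]) blast
  have bnd: "\<bar>indicator A s - g s\<bar> \<le> indicator (U - A) s + indicator (U - C) s" for s
    using g(2-5)[of s] U(2) C(2) by (auto simp: indicator_def)
  have finU: "emeasure m (U - B) < \<infinity>" if "B \<in> sets m" for B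
    using emeasure_mono[of "U - B" U m] Us Ufin by (auto intro: order.strict_trans1)
  have int: "integrable m (\<lambda>s. indicator (U - A) s + indicator (U - C) s :: real)"
    using Us A Cs finU by auto
  have "(\<integral>s. \<bar>indicator A s - g s\<bar> \<partial>m) \<le> (\<integral>s. indicator (U - A) s + indicator (U - C) s \<partial>m)"
    by (rule integral_mono'[OF int]) (use bnd in auto)
  also have "\<dots> = measure m (U - A) + measure m (U - C)"
    using Us A Cs finU by (subst Bochner_Integration.integral_add) auto
  also have "\<dots> < e" by (rule small)
  finally show thesis using g(1) that by blast
qed

lemma Cc_dense:
  fixes f :: "'a \<Rightarrow> complex"
  assumes "integrable m f" "0 < e"
  shows "\<exists>g\<in>Cc. (\<integral>s. norm (f s - g s) \<partial>m) < e"
  using assms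
proof (induction f arbitrary: e rule: integrable_induct)
  case (base A c)
  have pos: "0 < e / (norm c + 1)"
    using base by (simp add: add_nonneg_pos)
  obtain g where g: "(\<lambda>s. complex_of_real (g s)) \<in> Cc"
    "(\<integral>s. \<bar>indicator A s - g s\<bar> \<partial>m) < e / (norm c + 1)"
    by (rule indicator_Cc_approx[OF base(1,2) pos])
  have "(\<lambda>s. c * complex_of_real (g s)) \<in> Cc"
    using g(1) by (auto simp: Cc_def intro!: continuous_intros)
  moreover have "(\<integral>s. norm (indicator A s *\<^sub>R c - c * complex_of_real (g s)) \<partial>m) < e"
  proof -
    have "norm (indicator A s *\<^sub>R c - c * complex_of_real (g s)) = norm c * \<bar>indicator A s - g s\<bar>" for s
      unfolding scaleR_conv_of_real
      by (simp add: mult.commute[of _ c] norm_mult flip: right_diff_distrib of_real_diff)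
    then have "(\<integral>s. norm (indicator A s *\<^sub>R c - c * complex_of_real (g s)) \<partial>m) =
        norm c * (\<integral>s. \<bar>indicator A s - g s\<bar> \<partial>m)" by simp
    also have "\<dots> \<le> norm c * (e / (norm c + 1))"
      using g(2) by (intro mult_left_mono) auto
    also have "\<dots> < e"
      using base(3) pos by (simp add: field_simps zero_less_divide_iff)
    finally show ?thesis .
  qed
  ultimately show ?case
    by (intro bexI[of _ "\<lambda>s. c * complex_of_real (g s)"])
next
  case (add f g)
  from add(3)[of "e / 2"] add(4)[of "e / 2"] add(5) obtain u v where
    uv: "u \<in> Cc" "v \<in> Cc" "(\<integral>s. norm (f s - u s) \<partial>m) < e / 2" "(\<integral>s. norm (g s - v s) \<partial>m) < e / 2"
    by auto
  have int: "integrable m (\<lambda>s. norm (f s - u s))" "integrable m (\<lambda>s. norm (g s - v s))"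
    using add uv Cc_integrable by auto
  have "(\<integral>s. norm (f s + g s - (u s + v s)) \<partial>m) \<le> (\<integral>s. norm (f s - u s) + norm (g s - v s) \<partial>m)"
    by (rule integral_mono') (use int in \<open>auto simp: norm_diff_triangle_ineq\<close>)
  also have "\<dots> < e" using int uv by simp
  finally show ?case
    using Cc_add[OF uv(1,2)] by (intro bexI[of _ "\<lambda>s. u s + v s"])
next
  case (lim f s)
  have "(\<lambda>i. \<integral>x. norm (f x - s i x) \<partial>m) \<longlonglongrightarrow> (\<integral>x. 0 \<partial>m)"
  \<comment> \<open>The simple functions satisfy norm (s i x) \<le> 2 * norm (f x), which gives the
    factor 3.\<close>
  proof (rule integral_dominated_convergence[where w = "\<lambda>x. 3 * norm (f x)"])
    show "AE x in m. (\<lambda>i. norm (f x - s i x)) \<longlonglongrightarrow> 0"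
    proof (rule AE_I2)
      fix x assume "x \<in> space m"
      then have "(\<lambda>i. norm (f x - s i x)) \<longlonglongrightarrow> norm (f x - f x)"
        by (intro tendsto_norm tendsto_diff tendsto_const lim.hyps(2))
      then show "(\<lambda>i. norm (f x - s i x)) \<longlonglongrightarrow> 0" by simp
    qed
    show "AE x in m. norm (norm (f x - s i x)) \<le> 3 * norm (f x)" for i
    proof (rule AE_I2)
      fix x assume "x \<in> space m"
      then show "norm (norm (f x - s i x)) \<le> 3 * norm (f x)"
        using lim.hyps(3)[of x i] norm_triangle_ineq4[of "f x" "s i x"] by simp
    qed
  qed (use lim in auto)
  then have "eventually (\<lambda>i. (\<integral>x. norm (f x - s i x) \<partial>m) < e / 2) sequentially"
    using lim.prems by (intro order_tendstoD) auto
  then obtain i where i: "(\<integral>x. norm (f x - s i x) \<partial>m) < e / 2"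
    by (auto simp: eventually_sequentially)
  from lim.IH[of "e / 2" i] lim.prems obtain u where
    u: "u \<in> Cc" "(\<integral>x. norm (s i x - u x) \<partial>m) < e / 2" by auto
  have int: "integrable m (\<lambda>x. norm (f x - s i x))" "integrable m (\<lambda>x. norm (s i x - u x))"
    using lim u Cc_integrable by auto
  have "(\<integral>x. norm (f x - u x) \<partial>m) \<le> (\<integral>x. norm (f x - s i x) + norm (s i x - u x) \<partial>m)"
    by (rule integral_mono') (use int in \<open>auto intro: norm_triangle_sub norm_diff_triangle_le\<close>)
  also have "\<dots> < e" using int u i by simp
  finally show ?case using u(1) by blast
qed

end

section \<open>Riemann sums of translates\<close>

lemma compact_diff_set:
  fixes A B :: "'a::topological_group_add set"
  assumes "compact A" "compact B"
  shows "compact ((\<lambda>(a, b). a - b) ` (A \<times> B))"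
  unfolding split_beta
  by (intro compact_continuous_image compact_Times assms continuous_intros)

lemma disjointify_finite:
  assumes "finite T" "\<And>t. t \<in> T \<Longrightarrow> B t \<in> sets M"
  obtains A where "\<And>t. t \<in> T \<Longrightarrow> A t \<in> sets M" "\<And>t. t \<in> T \<Longrightarrow> A t \<subseteq> B t"
    "disjoint_family_on A T" "(\<Union>t\<in>T. A t) = (\<Union>t\<in>T. B t)"
  using assms
proof (induction T arbitrary: thesis rule: finite_induct)
  case empty
  then show ?case by (simp add: disjoint_family_on_def)
next
  case (insert t T)
  obtain A where A: "\<And>t. t \<in> T \<Longrightarrow> A t \<in> sets M" "\<And>t. t \<in> T \<Longrightarrow> A t \<subseteq> B t"
    "disjoint_family_on A T" "(\<Union>t\<in>T. A t) = (\<Union>t\<in>T. B t)"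
    using insert.IH insert.prems(2) by blast
  let ?A = "A(t := B t - (\<Union>t\<in>T. B t))"
  have eq: "?A u = A u" if "u \<in> T" for u using that insert.hyps by auto
  show ?case
  proof (rule insert.prems(1)[of ?A])
    show "?A u \<in> sets M" if "u \<in> insert t T" for u
      using that A insert by (auto intro!: sets.Diff sets.finite_UN)
    show "?A u \<subseteq> B u" if "u \<in> insert t T" for u
      using that A(2) by auto
    show "disjoint_family_on ?A (insert t T)"
      unfolding disjoint_family_on_def
    proof (intro ballI impI)
      fix u v assume uv: "u \<in> insert t T" "v \<in> insert t T" "u \<noteq> v"
      show "?A u \<inter> ?A v = {}"
      proof -
        have "A w \<inter> (B t - (\<Union>t\<in>T. B t)) = {}" if "w \<in> T" for w
          using A(2)[OF that] that by blast
        then show ?thesis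
          using uv A(3) by (cases "u = t"; cases "v = t") (auto simp: disjoint_family_on_def)
      qed
    qed
    have "(\<Union>u\<in>T. ?A u) = (\<Union>u\<in>T. B u)" using eq A(4) by simp
    then show "(\<Union>u\<in>insert t T. ?A u) = (\<Union>u\<in>insert t T. B u)"
      by auto
  qed
qed

context lc_haar
begin

text \<open>A finite partition of \<open>H\<close> indexed by its tags. The cell of \<open>t\<close>
  lies in the left translate of \<open>V\<close> by \<open>t\<close>; the tag itself need not belong
  to its cell.\<close>

definition tagged_cells :: "'a set \<Rightarrow> 'a set \<Rightarrow> 'a set \<Rightarrow> ('a \<Rightarrow> 'a set) \<Rightarrow> bool" where
  "tagged_cells V H I A \<longleftrightarrow> finite I \<and> (\<forall>t\<in>I. A t \<in> sets m) \<and> disjoint_family_on A I \<and>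
     (\<Union>t\<in>I. A t) = H \<and> (\<forall>t\<in>I. \<forall>x\<in>A t. - t + x \<in> V)"

text \<open>A Riemann sum for the vector-valued integral of t * f over the union of the
  cells.\<close>

definition riemann :: "'a set \<Rightarrow> ('a \<Rightarrow> 'a set) \<Rightarrow> ('a \<Rightarrow> complex) \<Rightarrow> 'a \<Rightarrow> complex" where
  "riemann I A f = (\<lambda>s. \<Sum>t\<in>I. of_real (measure m (A t)) * ltranslate t f s)"

lemma tagged_cells_exist:
  assumes H: "compact H" and V: "open V" "0 \<in> V"
  obtains I A where "tagged_cells V H I A"
proof -
  obtain T where T: "T \<subseteq> H" "finite T" "H \<subseteq> (\<Union>t\<in>T. (+) t ` V)"
    by (rule compactE_image[OF H, of H "\<lambda>t. (+) t ` V"])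
      (use V in \<open>auto intro!: open_translate image_eqI[of _ _ 0]\<close>)
  define B where "B t = H \<inter> (+) t ` V" for t
  have "B t \<in> sets m" for t
    using compact_sets[OF H] open_translate[OF V(1)] by (auto simp: B_def sets_m)
  with T(2) obtain A where A: "\<And>t. t \<in> T \<Longrightarrow> A t \<in> sets m" "\<And>t. t \<in> T \<Longrightarrow> A t \<subseteq> B t"
    "disjoint_family_on A T" "(\<Union>t\<in>T. A t) = (\<Union>t\<in>T. B t)"
    by (rule disjointify_finite[of T B m]) auto
  have "(\<Union>t\<in>T. B t) = H" using T(3) by (auto simp: B_def)
  moreover have "- t + x \<in> V" if "t \<in> T" "x \<in> A t" for t x
    using A(2)[OF that(1)] that(2) by (auto simp: B_def simp flip: add.assoc)
  ultimately have "tagged_cells V H T A"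
    using A T by (simp add: tagged_cells_def)
  then show thesis by (rule that)
qed

lemma measure_cells:
  assumes "tagged_cells V H I A" "compact H" "B \<in> sets m" "B \<subseteq> H"
  shows "measure m B = (\<Sum>t\<in>I. measure m (A t \<inter> B))"
proof -
  have fin: "emeasure m (A t \<inter> B) \<noteq> \<infinity>" for t
  proof -
    have "emeasure m (A t \<inter> B) \<le> emeasure m H"
      by (rule emeasure_mono) (use assms(4) compact_sets[OF assms(2)] in auto)
    also have "\<dots> < \<infinity>" by (rule compact_finite[OF assms(2)])
    finally show ?thesis by simp
  qed
  have "B = (\<Union>t\<in>I. A t \<inter> B)"
    using assms by (auto simp: tagged_cells_def)
  then have "measure m B = measure m (\<Union>t\<in>I. A t \<inter> B)" by simp
  also have "\<dots> = (\<Sum>t\<in>I. measure m (A t \<inter> B))"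
    using assms fin disjoint_family_on_bisimulation[of A I "\<lambda>t. A t \<inter> B"]
    by (intro measure_finite_Union) (auto simp: tagged_cells_def)
  finally show ?thesis .
qed

lemma cells_subset: "tagged_cells V H I A \<Longrightarrow> t \<in> I \<Longrightarrow> A t \<subseteq> H"
  by (auto simp: tagged_cells_def)

lemma measure_cells_total:
  assumes "tagged_cells V H I A" "compact H"
  shows "(\<Sum>t\<in>I. measure m (A t)) = measure m H"
proof -
  have "A t \<inter> H = A t" if "t \<in> I" for t using cells_subset[OF assms(1) that] by auto
  then show ?thesis using measure_cells[OF assms compact_sets[OF assms(2)]] by simp
qed

text \<open>Both sums are written over the common refinement. Disjoint cells contribute nothing, so
  two tags are compared only when their cells share a point.\<close>

lemma riemann_diff_refine:
  assumes A: "tagged_cells V H I A" and B: "tagged_cells W H J B" and H: "compact H"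
  shows "riemann I A f s - riemann J B f s =
    (\<Sum>(t, u)\<in>I \<times> J. of_real (measure m (A t \<inter> B u)) * (ltranslate t f s - ltranslate u f s))"
proof -
  have mA: "measure m (A t) = (\<Sum>u\<in>J. measure m (A t \<inter> B u))" if "t \<in> I" for t
    using measure_cells[OF B H _ cells_subset[OF A that]] A that
    by (simp add: tagged_cells_def Int_commute)
  have mB: "measure m (B u) = (\<Sum>t\<in>I. measure m (A t \<inter> B u))" if "u \<in> J" for u
    using measure_cells[OF A H _ cells_subset[OF B that]] B that
    by (simp add: tagged_cells_def)
  have "riemann I A f s = (\<Sum>t\<in>I. \<Sum>u\<in>J. of_real (measure m (A t \<inter> B u)) * ltranslate t f s)"
    by (simp add: riemann_def mA sum_distrib_right)
  moreover have "riemann J B f s = (\<Sum>u\<in>J. \<Sum>t\<in>I. of_real (measure m (A t \<inter> B u)) * ltranslate u f s)"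
    by (simp add: riemann_def mB sum_distrib_right)
  ultimately show ?thesis
    by (subst (asm) (2) sum.swap)
      (simp add: sum.cartesian_product sum_subtractf right_diff_distrib split_beta)
qed

lemma ltranslate_integral:
  assumes "integrable m h"
  shows "integrable m (ltranslate t h)" "(\<integral>s. norm (ltranslate t h s) \<partial>m) = (\<integral>s. norm (h s) \<partial>m)"
  using integrable_translate[of h "- t"] integral_translate[of "\<lambda>s. norm (h s)" "- t"] assms
  by (auto simp: ltranslate_def)

text \<open>The bound does not depend on the partition: a small change of the function in $L^1(G)$
  changes all its Riemann sums over \<open>H\<close> by a uniformly small amount.\<close>

lemma riemann_L1_le:
  assumes A: "tagged_cells V H I A" and H: "compact H" and h: "integrable m h"
  shows "integrable m (riemann I A h)"
    and "(\<integral>s. norm (riemann I A h s) \<partial>m) \<le> measure m H * (\<integral>s. norm (h s) \<partial>m)"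
proof -
  show int: "integrable m (riemann I A h)"
    unfolding riemann_def using ltranslate_integral(1)[OF h] by auto
  have "(\<integral>s. norm (riemann I A h s) \<partial>m) \<le> (\<integral>s. (\<Sum>t\<in>I. measure m (A t) * norm (ltranslate t h s)) \<partial>m)"
    by (rule integral_mono')
      (use ltranslate_integral(1)[OF h] in \<open>auto simp: riemann_def norm_mult sum_nonneg intro!: sum_norm_le\<close>)
  also have "\<dots> = (\<Sum>t\<in>I. measure m (A t) * (\<integral>s. norm (h s) \<partial>m))"
    by (subst Bochner_Integration.integral_sum)
      (use ltranslate_integral[OF h] in auto)
  also have "\<dots> = measure m H * (\<integral>s. norm (h s) \<partial>m)"
    unfolding measure_cells_total[OF A H, symmetric] by (simp add: sum_distrib_right)
  finally show "(\<integral>s. norm (riemann I A h s) \<partial>m) \<le> measure m H * (\<integral>s. norm (h s) \<partial>m)" .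
qed

lemma
  fixes c :: complex
  assumes "A \<in> sets m" "emeasure m A < \<infinity>"
  shows integrable_indicator_mult: "integrable m (\<lambda>x. indicator A x * c)"
    and integral_indicator_mult: "(\<integral>x. indicator A x * c \<partial>m) = of_real (measure m A) * c"
proof -
  have eq: "indicator A x * c = (indicator A x :: real) *\<^sub>R c" for x
    by (simp add: indicator_def)
  show "integrable m (\<lambda>x. indicator A x * c)"
    unfolding eq using assms by (intro integrable_scaleR_left) simp
  show "(\<integral>x. indicator A x * c \<partial>m) = of_real (measure m A) * c"
    unfolding eq using assms by (subst integral_scaleR_left) (simp_all add: scaleR_conv_of_real)
qed

text \<open>For \<open>s \<in> K\<close> the substitution \<open>x \<mapsto> s + x\<close> turns the integral of \<open>\<phi> (- x + s)\<close> over
  \<open>K - E\<close> into the integral of \<open>\<phi> (- x)\<close> over the whole group, which does not depend on \<open>s\<close>.\<close>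

lemma riemann_near_constant:
  assumes A: "tagged_cells V ((\<lambda>(a, b). a - b) ` (K \<times> E)) I A" and K: "compact K" and E: "compact E"
    and \<phi>: "\<phi> \<in> Cc" "\<And>s. s \<notin> E \<Longrightarrow> \<phi> s = 0" and s: "s \<in> K"
    and V: "\<And>v y. v \<in> V \<Longrightarrow> norm (\<phi> (v + y) - \<phi> y) \<le> e"
  shows "norm (riemann I A \<phi> s - (\<integral>x. \<phi> (- x) \<partial>m)) \<le> e * measure m ((\<lambda>(a, b). a - b) ` (K \<times> E))"
proof -
  define H where "H = (\<lambda>(a, b). a - b) ` (K \<times> E)"
  have H: "compact H" unfolding H_def by (rule compact_diff_set[OF K E])
  note A' = A[folded H_def]
  have fin: "finite I" and Am: "\<And>t. t \<in> I \<Longrightarrow> A t \<in> sets m"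
    using A' by (auto simp: tagged_cells_def)
  have Afin: "emeasure m (A t) < \<infinity>" if "t \<in> I" for t
    using emeasure_mono[OF cells_subset[OF A' that] compact_sets[OF H]] compact_finite[OF H]
    by (rule order.strict_trans1)
  have cont: "continuous_on UNIV \<phi>" using \<phi>(1) by (simp add: Cc_def)
  have cont': "continuous_on UNIV (\<lambda>x. \<phi> (- x + s))"
    by (intro continuous_on_compose2[OF cont] continuous_intros) auto
  have meas: "(\<lambda>x. indicator H x * \<phi> (- x + s)) \<in> borel_measurable m"
    using continuous_measurable_m[OF cont'] compact_sets[OF H] by measurable
  have "(\<integral>x. indicator H x * \<phi> (- x + s) \<partial>m) = (\<integral>x. indicator H (s + x) * \<phi> (- (s + x) + s) \<partial>m)"
    by (rule integral_translate[OF meas, symmetric])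
  also have "(\<lambda>x. indicator H (s + x) * \<phi> (- (s + x) + s)) = (\<lambda>x. \<phi> (- x))"
  proof
    fix x
    have "- (s + x) + s = - x" by (simp add: minus_add add.assoc)
    moreover have "s + x \<in> H" if "\<phi> (- x) \<noteq> 0"
      using \<phi>(2)[of "- x"] that s unfolding H_def by (force intro!: image_eqI[of _ _ "(s, - x)"])
    ultimately show "indicator H (s + x) * \<phi> (- (s + x) + s) = \<phi> (- x)"
      by (auto simp: indicator_def)
  qed
  finally have const: "(\<integral>x. indicator H x * \<phi> (- x + s) \<partial>m) = (\<integral>x. \<phi> (- x) \<partial>m)" .
  have ind: "indicator H x = (\<Sum>t\<in>I. indicator (A t) x :: 'b::semiring_1)" for x
    using indicator_UN_disjoint[OF fin, of A x] A' by (simp add: tagged_cells_def)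
  obtain B where B: "\<And>y. norm (\<phi> y) \<le> B"
  proof -
    have "compact (\<phi> ` E)" using E cont by (intro compact_continuous_image continuous_on_subset[OF cont]) auto
    then obtain B where B: "\<forall>x\<in>\<phi> ` E. norm x \<le> B"
      using compact_imp_bounded bounded_iff by metis
    show thesis
    proof
      show "norm (\<phi> y) \<le> max B 0" for y
        using B \<phi>(2)[of y] by (cases "y \<in> E") (auto simp: le_max_iff_disj)
    qed
  qed
  have int1: "integrable m (\<lambda>x. indicator H x * \<phi> (- x + s))"
    by (rule integrable_bounded_compact[OF meas, of B H])
      (use B H order_trans[OF norm_ge_zero B] in \<open>auto simp: indicator_def\<close>)
  have int2: "integrable m (\<lambda>x. \<Sum>t\<in>I. indicator (A t) x * ltranslate t \<phi> s)"
    by (intro Bochner_Integration.integrable_sum integrable_indicator_mult Am Afin)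
  have "riemann I A \<phi> s = (\<integral>x. (\<Sum>t\<in>I. indicator (A t) x * ltranslate t \<phi> s) \<partial>m)"
    unfolding riemann_def
    by (subst Bochner_Integration.integral_sum[OF integrable_indicator_mult[OF Am Afin]])
      (simp_all add: integral_indicator_mult[OF Am Afin] del: integral_mult_left_zero)
  then have "riemann I A \<phi> s - (\<integral>x. \<phi> (- x) \<partial>m) =
      (\<integral>x. (\<Sum>t\<in>I. indicator (A t) x * ltranslate t \<phi> s) - indicator H x * \<phi> (- x + s) \<partial>m)"
    unfolding const[symmetric] using int1 int2 by simp
  also have "norm \<dots> \<le> (\<integral>x. norm ((\<Sum>t\<in>I. indicator (A t) x * ltranslate t \<phi> s) - indicator H x * \<phi> (- x + s)) \<partial>m)"
    by (rule integral_norm_bound)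
  also have "\<dots> \<le> (\<integral>x. e * indicator H x \<partial>m)"
  proof (rule integral_mono')
    show "integrable m (\<lambda>x. e * indicator H x :: real)"
      using compact_sets[OF H] compact_finite[OF H] by simp
    fix x
    have "norm ((\<Sum>t\<in>I. indicator (A t) x * ltranslate t \<phi> s) - indicator H x * \<phi> (- x + s)) =
        norm (\<Sum>t\<in>I. indicator (A t) x * (ltranslate t \<phi> s - \<phi> (- x + s)))"
      unfolding ind by (simp add: sum_distrib_right sum_subtractf right_diff_distrib)
    also have "\<dots> \<le> (\<Sum>t\<in>I. indicator (A t) x * e)"
    proof (rule sum_norm_le)
      fix t assume t: "t \<in> I"
      show "norm (indicator (A t) x * (ltranslate t \<phi> s - \<phi> (- x + s))) \<le> indicator (A t) x * e"
      proof (cases "x \<in> A t")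
        case True
        then have "- t + x \<in> V" using A' t by (auto simp: tagged_cells_def)
        \<comment> \<open>Write - t + s = (- t + x) + (- x + s): the cell condition puts the first
          summand into \<open>V\<close>.\<close>
        from V[OF this, of "- x + s"] have "norm (\<phi> (- t + s) - \<phi> (- x + s)) \<le> e"
          by (simp add: add.assoc)
        then show ?thesis using True by (simp add: ltranslate_def)
      qed simp
    qed
    also have "\<dots> = e * indicator H x"
      unfolding ind by (simp add: sum_distrib_left mult.commute)
    finally show "norm ((\<Sum>t\<in>I. indicator (A t) x * ltranslate t \<phi> s) - indicator H x * \<phi> (- x + s)) \<le> e * indicator H x" .
    then show "0 \<le> e * indicator H x" by (rule order_trans[OF norm_ge_zero])
  qed
  also have "\<dots> = e * measure m H" by simp
  finally show ?thesis by (simp add: H_def)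
qed

end

section \<open>Vector-valued integration in a Segal algebra\<close>

locale lc_segal = lc_haar m + segal_algebra m S N
  for m :: "'a::{topological_group_add,t2_space} measure" and S N
begin

lemma riemann_mem: "finite I \<Longrightarrow> f \<in> S \<Longrightarrow> riemann I A f \<in> S"
  unfolding riemann_def by (intro sum_mem scale_mem ltranslate_mem)

text \<open>If the cells of \<open>t\<close> and \<open>u\<close> share a point \<open>x\<close>,
  both translates of \<open>f\<close> are close to its translate by \<open>x\<close>. The weights of
  the common refinement add up to the measure of \<open>H\<close>.\<close>

lemma norm_riemann_diff_le:
  assumes f: "f \<in> S" and A: "tagged_cells V H I A" and B: "tagged_cells W H J B" and H: "compact H"
    and V: "\<And>v. v \<in> V \<Longrightarrow> N (\<lambda>s. ltranslate v f s - f s) \<le> d"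
    and W: "\<And>v. v \<in> W \<Longrightarrow> N (\<lambda>s. ltranslate v f s - f s) \<le> e"
  shows "N (\<lambda>s. riemann I A f s - riemann J B f s) \<le> (d + e) * measure m H"
proof -
  have fin: "finite (I \<times> J)" using A B by (auto simp: tagged_cells_def)
  \<comment> \<open>Isometry of translation by \<open>t\<close> reduces the comparison at
    \<open>t\<close> to one at the identity.\<close>
  have shift: "N (\<lambda>s. ltranslate x f s - ltranslate t f s) = N (\<lambda>s. ltranslate (- t + x) f s - f s)" for t x
  proof -
    have "ltranslate t (\<lambda>s. ltranslate (- t + x) f s - f s) = (\<lambda>s. ltranslate x f s - ltranslate t f s)"
      by (simp add: ltranslate_def minus_add add.assoc)
    then show ?thesis
      using ltranslate_isometric[OF diff_mem[OF ltranslate_mem[OF f] f], of t "- t + x"] by simp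
  qed
  have "N (\<lambda>s. riemann I A f s - riemann J B f s) =
    N (\<lambda>s. \<Sum>z\<in>I \<times> J. of_real (measure m (A (fst z) \<inter> B (snd z))) * (ltranslate (fst z) f s - ltranslate (snd z) f s))"
    unfolding riemann_diff_refine[OF A B H] by (simp add: split_beta)
  also have "\<dots> \<le> (\<Sum>z\<in>I \<times> J. N (\<lambda>s. of_real (measure m (A (fst z) \<inter> B (snd z))) * (ltranslate (fst z) f s - ltranslate (snd z) f s)))"
    by (intro norm_sum_le fin scale_mem diff_mem ltranslate_mem f)
  also have "\<dots> \<le> (\<Sum>z\<in>I \<times> J. measure m (A (fst z) \<inter> B (snd z)) * (d + e))"
  proof (rule sum_mono)
    fix z assume "z \<in> I \<times> J"
    then obtain t u where z: "z = (t, u)" "t \<in> I" "u \<in> J" by auto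
    have "measure m (A t \<inter> B u) * N (\<lambda>s. ltranslate t f s - ltranslate u f s) \<le> measure m (A t \<inter> B u) * (d + e)"
    proof (cases "A t \<inter> B u = {}")
      case False
      then obtain x where x: "x \<in> A t" "x \<in> B u" by auto
      have "- t + x \<in> V" "- u + x \<in> W"
        using x z A B by (auto simp: tagged_cells_def)
      then have "N (\<lambda>s. ltranslate x f s - ltranslate t f s) \<le> d" "N (\<lambda>s. ltranslate x f s - ltranslate u f s) \<le> e"
        using V W by (simp_all add: shift)
      then have "N (\<lambda>s. ltranslate t f s - ltranslate u f s) \<le> d + e"
        using norm_diff_triangle[of "ltranslate t f" "ltranslate x f" "ltranslate u f"]
          norm_diff_commute[of "ltranslate t f" "ltranslate x f"] ltranslate_mem[OF f] by simp
      then show ?thesis by (intro mult_left_mono) auto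
    qed simp
    then show "N (\<lambda>s. of_real (measure m (A (fst z) \<inter> B (snd z))) * (ltranslate (fst z) f s - ltranslate (snd z) f s))
        \<le> measure m (A (fst z) \<inter> B (snd z)) * (d + e)"
      using norm_scale[OF diff_mem[OF ltranslate_mem[OF f] ltranslate_mem[OF f]]] by (simp add: z)
  qed
  also have "\<dots> = (\<Sum>t\<in>I. \<Sum>u\<in>J. measure m (A t \<inter> B u)) * (d + e)"
    by (simp add: sum.cartesian_product split_beta sum_distrib_right)
  also have "(\<Sum>t\<in>I. \<Sum>u\<in>J. measure m (A t \<inter> B u)) = (\<Sum>t\<in>I. measure m (A t))"
  proof (rule sum.cong[OF refl])
    fix t assume t: "t \<in> I"
    show "(\<Sum>u\<in>J. measure m (A t \<inter> B u)) = measure m (A t)"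
      using measure_cells[OF B H _ cells_subset[OF A t]] A t
      by (simp add: tagged_cells_def Int_commute)
  qed
  also have "\<dots> = measure m H" by (rule measure_cells_total[OF A H])
  finally show ?thesis by (simp add: mult.commute)
qed

lemma ltranslate_near_identity:
  assumes "f \<in> S" "0 < e"
  obtains V where "open V" "0 \<in> V" "\<And>v. v \<in> V \<Longrightarrow> N (\<lambda>s. ltranslate v f s - f s) \<le> e"
proof -
  have "ltranslate 0 f = f" by (simp add: ltranslate_def)
  then have "eventually (\<lambda>t. N (\<lambda>s. ltranslate t f s - f s) < e) (at 0)"
    using order_tendstoD(2)[OF ltranslate_continuous[OF assms(1), of 0] assms(2)] by simp
  then obtain V where V: "open V" "0 \<in> V" "\<And>v. v \<in> V \<Longrightarrow> v \<noteq> 0 \<Longrightarrow> N (\<lambda>s. ltranslate v f s - f s) < e"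
    unfolding eventually_at_topological by blast
  \<comment> \<open>The limit says nothing at v = 0 itself, where the difference is the zero
    function.\<close>
  have "N (\<lambda>s. ltranslate v f s - f s) \<le> e" if "v \<in> V" for v
    using V(3)[OF that] \<open>ltranslate 0 f = f\<close> norm_zero_fun assms(2) by (cases "v = 0") auto
  with V show thesis by (intro that) auto
qed

text \<open>A sequence of neighbourhoods, chosen according to \<open>N\<close> and \<open>f\<close>,
  suffices to construct \<open>g\<close> even if the group is not first countable. The estimate
  covers all finer partitions so that \<open>V\<close> can later be intersected with a neighbourhood
  dictated by another function.\<close>

lemma riemann_limit:
  assumes f: "f \<in> S" and H: "compact H"
  obtains g where "g \<in> S"
    "\<And>e. 0 < e \<Longrightarrow> \<exists>V. open V \<and> 0 \<in> V \<and> (\<forall>V' I A. V' \<subseteq> V \<longrightarrow> tagged_cells V' H I A \<longrightarrow> N (\<lambda>s. riemann I A f s - g s) \<le> e)"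
proof -
  have "\<exists>V. open V \<and> 0 \<in> V \<and> (\<forall>v\<in>V. N (\<lambda>s. ltranslate v f s - f s) \<le> 1 / Suc n)" for n :: nat
    by (rule ltranslate_near_identity[OF f, of "1 / Suc n"]) auto
  then obtain V where V: "\<And>n. open (V n)" "\<And>n. 0 \<in> V n"
    "\<And>n v. v \<in> V n \<Longrightarrow> N (\<lambda>s. ltranslate v f s - f s) \<le> 1 / Suc n"
    by metis
  have "\<exists>I A. tagged_cells (V n) H I A" for n
    by (rule tagged_cells_exist[OF H V(1,2)]) blast
  then obtain I A where IA: "\<And>n. tagged_cells (V n) H (I n) (A n)"
    by metis
  define F where "F n = riemann (I n) (A n) f" for n
  have FS: "F n \<in> S" for n
    unfolding F_def using IA[of n] f by (intro riemann_mem) (auto simp: tagged_cells_def)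
  have null: "(\<lambda>n. 2 * measure m H * (1 / Suc n)) \<longlonglongrightarrow> 0"
    using tendsto_mult_right_zero[OF LIMSEQ_inverse_real_of_nat, of "2 * measure m H"]
    by (simp add: inverse_eq_divide)
  have "\<exists>g\<in>S. (\<lambda>n. N (\<lambda>s. F n s - g s)) \<longlonglongrightarrow> 0"
  proof (rule complete[OF FS])
    fix e :: real assume "0 < e"
    then have "eventually (\<lambda>n. 2 * measure m H * (1 / Suc n) < e) sequentially"
      using order_tendstoD(2)[OF null] by simp
    then obtain M where M: "2 * measure m H * (1 / Suc M) < e"
      by (auto simp: eventually_sequentially)
    have "N (\<lambda>s. F k s - F n s) < e" if "M \<le> k" "M \<le> n" for k n
    proof -
      have "N (\<lambda>s. F k s - F n s) \<le> (1 / Suc k + 1 / Suc n) * measure m H"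
        unfolding F_def by (rule norm_riemann_diff_le[OF f IA IA H V(3) V(3)])
      also have "\<dots> \<le> (1 / Suc M + 1 / Suc M) * measure m H"
        using that by (intro mult_right_mono add_mono divide_left_mono) auto
      also have "\<dots> < e" using M by (simp add: field_simps)
      finally show ?thesis .
    qed
    then show "\<exists>M. \<forall>k\<ge>M. \<forall>n\<ge>M. N (\<lambda>s. F k s - F n s) < e" by blast
  qed
  then obtain g where g: "g \<in> S" "(\<lambda>n. N (\<lambda>s. F n s - g s)) \<longlonglongrightarrow> 0" by blast
  show thesis
  proof (rule that[OF g(1)])
    fix e :: real assume "0 < e"
    moreover have "(\<lambda>n. 2 * measure m H * (1 / Suc n) + N (\<lambda>s. F n s - g s)) \<longlonglongrightarrow> 0 + 0"
      by (intro tendsto_add null g(2))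
    ultimately have "eventually (\<lambda>n. 2 * measure m H * (1 / Suc n) + N (\<lambda>s. F n s - g s) < e) sequentially"
      by (intro order_tendstoD(2)) auto
    then obtain n where n: "2 * measure m H * (1 / Suc n) + N (\<lambda>s. F n s - g s) < e"
      by (auto simp: eventually_sequentially)
    have "N (\<lambda>s. riemann J B f s - g s) \<le> e" if W: "W \<subseteq> V n" and B: "tagged_cells W H J B" for W J B
    proof -
      have RS: "riemann J B f \<in> S"
        using B f by (intro riemann_mem) (auto simp: tagged_cells_def)
      have "N (\<lambda>s. riemann J B f s - F n s) \<le> (1 / Suc n + 1 / Suc n) * measure m H"
        unfolding F_def by (rule norm_riemann_diff_le[OF f B IA H]) (use W V(3) in auto)
      also have "\<dots> = 2 * measure m H * (1 / Suc n)" by simp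
      finally show ?thesis
        using norm_diff_triangle[OF RS FS g(1), of n] n by linarith
    qed
    then show "\<exists>V. open V \<and> 0 \<in> V \<and> (\<forall>V' I A. V' \<subseteq> V \<longrightarrow> tagged_cells V' H I A \<longrightarrow> N (\<lambda>s. riemann I A f s - g s) \<le> e)"
      using V(1,2) by (intro exI[of _ "V n"] conjI allI impI) simp_all
  qed
qed

end

section \<open>An element of the Segal algebra that is constant on a compact set\<close>

context lc_segal
begin

text \<open>On \<open>K\<close> three errors add up: \<open>g\<close> against the Riemann sum of
  \<open>f\<close> (small in \<open>N\<close>), that sum against the one of \<open>\<phi>\<close>
  (bounded in $L^1(G)$ for every partition), and the latter against its constant (uniformly small).
  Refinement removes the first and the third.\<close>

lemma riemann_limit_near_constant:
  assumes f: "f \<in> S" and K: "compact K" and E: "compact E" and g: "g \<in> S"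
    and lim: "\<And>e. 0 < e \<Longrightarrow> \<exists>V. open V \<and> 0 \<in> V \<and> (\<forall>V' I A. V' \<subseteq> V \<longrightarrow>
      tagged_cells V' ((\<lambda>(a, b). a - b) ` (K \<times> E)) I A \<longrightarrow> N (\<lambda>s. riemann I A f s - g s) \<le> e)"
    and \<phi>: "\<phi> \<in> Cc" "\<And>s. s \<notin> E \<Longrightarrow> \<phi> s = 0"
  shows "(\<integral>s. indicator K s * norm (g s - (\<integral>x. \<phi> (- x) \<partial>m)) \<partial>m)
    \<le> measure m ((\<lambda>(a, b). a - b) ` (K \<times> E)) * (\<integral>s. norm (f s - \<phi> s) \<partial>m)"
proof -
  define H where "H = (\<lambda>(a, b). a - b) ` (K \<times> E)"
  have H: "compact H" unfolding H_def by (rule compact_diff_set[OF K E])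
  define c where "c = (\<integral>x. \<phi> (- x) \<partial>m)"
  obtain C where C: "0 < C" "\<And>f. f \<in> S \<Longrightarrow> (\<integral>s. norm (f s) \<partial>m) \<le> C * N f"
    by (rule L1_le_norm) blast
  have int\<phi>: "integrable m (\<lambda>s. f s - \<phi> s)"
    using subset_L1[OF f] Cc_integrable[OF \<phi>(1)] by simp
  \<comment> \<open>\<open>B\<close> collects the coefficients of \<open>e\<close> in the first and
    third errors.\<close>
  define B where "B = C + measure m H * measure m K"
  have B: "0 < B" using C by (simp add: B_def add_pos_nonneg)
  have main: "(\<integral>s. indicator K s * norm (g s - c) \<partial>m) \<le> measure m H * (\<integral>s. norm (f s - \<phi> s) \<partial>m) + B * e"
    if e: "0 < e" for e
  proof -
    obtain V1 where V1: "open V1" "0 \<in> V1"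
      "\<And>V' I A. V' \<subseteq> V1 \<Longrightarrow> tagged_cells V' H I A \<Longrightarrow> N (\<lambda>s. riemann I A f s - g s) \<le> e"
      using lim[OF e] unfolding H_def by blast
    obtain V2 where V2: "open V2" "0 \<in> V2" "\<And>v s. v \<in> V2 \<Longrightarrow> norm (\<phi> (v + s) - \<phi> s) < e"
      by (rule Cc_uniformly_continuous[OF \<phi>(1) e]) (rule that)
    obtain I A where IA: "tagged_cells (V1 \<inter> V2) H I A"
      by (rule tagged_cells_exist[OF H, of "V1 \<inter> V2"]) (use V1 V2 in auto)
    have RS: "riemann I A f \<in> S"
      using IA f by (intro riemann_mem) (auto simp: tagged_cells_def)
    have R1: "(\<integral>s. norm (riemann I A f s - g s) \<partial>m) \<le> C * e"
      using C(2)[OF diff_mem[OF RS g]] V1(3)[OF _ IA] C(1) by (fastforce intro: order_trans mult_left_mono)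
    have Rsub: "riemann I A f s - riemann I A \<phi> s = riemann I A (\<lambda>s. f s - \<phi> s) s" for s
      by (simp add: riemann_def ltranslate_def sum_subtractf right_diff_distrib)
    note R2 = riemann_L1_le[OF IA H int\<phi>]
    have R3: "norm (riemann I A \<phi> s - c) \<le> e * measure m H" if "s \<in> K" for s
      unfolding c_def H_def
      by (rule riemann_near_constant[OF IA[unfolded H_def] K E \<phi> that]) (use V2(3) in \<open>auto intro: less_imp_le\<close>)
    define b where "b s = norm (riemann I A f s - g s) + norm (riemann I A (\<lambda>s. f s - \<phi> s) s)
      + e * measure m H * indicator K s" for s
    have intb1: "integrable m (\<lambda>s. norm (riemann I A f s - g s))"
      using subset_L1[OF diff_mem[OF RS g]] by simp
    have intb2: "integrable m (\<lambda>s. norm (riemann I A (\<lambda>s. f s - \<phi> s) s))"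
      using R2(1) by simp
    have intb3: "integrable m (\<lambda>s. e * measure m H * indicator K s :: real)"
      using compact_sets[OF K] compact_finite[OF K] by simp
    have intb: "integrable m b"
      unfolding b_def by (intro Bochner_Integration.integrable_add intb1 intb2 intb3)
    have b0: "0 \<le> b s" for s using e by (simp add: b_def)
    have le: "indicator K s * norm (g s - c) \<le> b s" for s
    proof (cases "s \<in> K")
      case True
      have tri: "norm (- x + y + z) \<le> norm x + norm y + norm z" for x y z :: complex
        using norm_triangle_ineq[of "- x + y" z] norm_triangle_ineq[of "- x" y] by simp
      have eq: "g s - c = - (riemann I A f s - g s) + riemann I A (\<lambda>s. f s - \<phi> s) s + (riemann I A \<phi> s - c)"
        unfolding Rsub[symmetric] by simp
      have "norm (g s - c) \<le> norm (riemann I A f s - g s) + norm (riemann I A (\<lambda>s. f s - \<phi> s) s)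
          + norm (riemann I A \<phi> s - c)"
        unfolding eq by (rule tri)
      then show ?thesis using R3[OF True] True by (simp add: b_def)
    next
      case False
      then show ?thesis using b0[of s] by simp
    qed
    have "(\<integral>s. indicator K s * norm (g s - c) \<partial>m) \<le> (\<integral>s. b s \<partial>m)"
      by (rule integral_mono'[OF intb]) (use le b0 in auto)
    also have "\<dots> = (\<integral>s. norm (riemann I A f s - g s) \<partial>m)
        + (\<integral>s. norm (riemann I A (\<lambda>s. f s - \<phi> s) s) \<partial>m) + e * measure m H * measure m K"
      unfolding b_def
      by (simp only: Bochner_Integration.integral_add[OF Bochner_Integration.integrable_add[OF intb1 intb2] intb3]
          Bochner_Integration.integral_add[OF intb1 intb2]) simp
    also have "\<dots> \<le> C * e + measure m H * (\<integral>s. norm (f s - \<phi> s) \<partial>m) + e * measure m H * measure m K"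
      using R1 R2(2) by simp
    finally show ?thesis by (simp add: B_def algebra_simps)
  qed
  have "(\<integral>s. indicator K s * norm (g s - c) \<partial>m) \<le> measure m H * (\<integral>s. norm (f s - \<phi> s) \<partial>m)"
  proof (rule field_le_epsilon)
    fix e :: real assume "0 < e"
    with B main[of "e / B"] show "(\<integral>s. indicator K s * norm (g s - c) \<partial>m)
        \<le> measure m H * (\<integral>s. norm (f s - \<phi> s) \<partial>m) + e" by simp
  qed
  then show ?thesis by (simp add: H_def c_def)
qed

end

section \<open>Bump functions in $A_p(G)$ and positivity of the constant\<close>

context lc_haar
begin

text \<open>A single convolution gives w(s) = m(K \<inter> sB) / m(K). With B = $D^{-1} K$ the
  translate sB contains K for s in D, so \<open>w\<close> is 1 there; \<open>w\<close> vanishes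
  unless s lies in $K B^{-1}$.\<close>

lemma Ap_bump:
  assumes p: "1 < p" and K: "compact K" "0 < measure m K" and D: "compact D"
  obtains w E where "w \<in> Ap m p" "compact E" "\<And>s. s \<notin> E \<Longrightarrow> w s = 0" "\<And>s. norm (w s) \<le> 1"
    "\<And>s. s \<in> D \<Longrightarrow> w s = 1"
proof -
  define B where "B = (\<lambda>(a, b). - a + b) ` (D \<times> K)"
  have B: "compact B" unfolding B_def split_beta
    by (intro compact_continuous_image compact_Times D K continuous_intros)
  define E where "E = (\<lambda>(a, b). a - b) ` (K \<times> B)"
  have E: "compact E" unfolding E_def by (rule compact_diff_set[OF K(1) B])
  define \<xi> where "\<xi> i = (\<lambda>t. if i = (0::nat) then indicator K t / of_real (measure m K) else 0 :: complex)" for i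
  define \<eta> where "\<eta> i = (\<lambda>t. if i = (0::nat) then indicator B t else 0 :: complex)" for i
  define w where "w = conv_fun m (\<xi> 0) (check_fun (\<eta> 0))"
  have ind: "(\<lambda>t. norm (indicator A t :: complex) powr r) = indicator A" for A :: "'a set" and r
    by (auto simp: indicator_def)
  have LpI: "indicator A \<in> Lp_fun m r" if "compact A" for A r
    using compact_sets[OF that] compact_finite[OF that] by (auto simp: Lp_fun_def ind)
  have Lp0: "(\<lambda>_. 0) \<in> Lp_fun m r" for r
    by (simp add: Lp_fun_def)
  have "\<xi> i \<in> Lp_fun m r" for i r
    using Lp_fun_scale[OF LpI[OF K(1)], of "1 / of_real (measure m K)" r] Lp0
    by (cases "i = 0") (simp_all add: \<xi>_def divide_inverse mult.commute)
  moreover have "\<eta> i \<in> Lp_fun m r" for i r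
    using LpI[OF B, of r] Lp0 by (cases "i = 0") (simp_all add: \<eta>_def)
  moreover have "summable (\<lambda>i. Lp_norm m (conj_exponent p) (\<xi> i) * Lp_norm m p (\<eta> i))"
    by (rule summable_finite[of "{0}"]) (auto simp: \<xi>_def \<eta>_def Lp_norm_def)
  moreover have "(\<lambda>i. conv_fun m (\<xi> i) (check_fun (\<eta> i)) s) sums w s" for s
  proof -
    have "conv_fun m (\<xi> i) (check_fun (\<eta> i)) s = 0" if "i \<noteq> 0" for i
      using that by (simp add: conv_fun_def \<xi>_def)
    then show ?thesis
      using sums_finite[of "{0}" "\<lambda>i. conv_fun m (\<xi> i) (check_fun (\<eta> i)) s"] by (simp add: w_def)
  qed
  ultimately have wA: "w \<in> Ap m p"
    unfolding Ap_def Ap_repr_def by blast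
  have ws: "w s = (\<integral>t. indicator (K \<inter> (+) s ` B) t / of_real (measure m K) \<partial>m)" for s
  proof -
    have "\<xi> 0 t * \<eta> 0 (- s + t) = indicator (K \<inter> (+) s ` B) t / of_real (measure m K)" for t
      using vimage_add[of "- s" B] by (auto simp: \<xi>_def \<eta>_def indicator_def)
    then show ?thesis by (simp add: w_def conv_check_fun)
  qed
  have KB: "compact (K \<inter> (+) s ` B)" for s
    using B K by (intro compact_Int_closed compact_imp_closed compact_continuous_image) (auto intro!: continuous_intros)
  have "w s = of_real (measure m (K \<inter> (+) s ` B) / measure m K)" for s
    unfolding ws divide_inverse
    using integral_indicator_mult[OF compact_sets[OF KB] compact_finite[OF KB], of s "inverse (of_real (measure m K))"]
    by (simp add: divide_inverse)
  note weq = this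
  show thesis
  proof (rule that[OF wA E])
    fix s
    show "w s = 0" if "s \<notin> E"
    proof -
      have "K \<inter> (+) s ` B = {}"
      proof (rule equals0I)
        fix t assume "t \<in> K \<inter> (+) s ` B"
        then obtain b where b: "b \<in> B" "s + b \<in> K" by auto
        then have "s \<in> E" unfolding E_def
          by (intro image_eqI[of _ _ "(s + b, b)"]) simp_all
        with that show False by simp
      qed
      then show ?thesis by (simp add: weq)
    qed
    have "measure m (K \<inter> (+) s ` B) \<le> measure m K"
      using compact_sets[OF KB] compact_sets[OF K(1)] compact_finite[OF K(1)]
      by (intro measure_mono_fmeasurable) (auto simp: fmeasurable_def)
    then show "norm (w s) \<le> 1"
      using K(2) by (simp add: weq norm_divide divide_le_eq_1)
    show "w s = 1" if "s \<in> D"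
    proof -
      have "K \<subseteq> (+) s ` B"
      proof
        fix t assume "t \<in> K"
        then have "- s + t \<in> B" unfolding B_def using that by force
        then show "t \<in> (+) s ` B" by (intro image_eqI[of _ _ "- s + t"]) (auto simp flip: add.assoc)
      qed
      then have "K \<inter> (+) s ` B = K" by auto
      then show ?thesis using K(2) by (simp add: weq)
    qed
  qed
qed

lemma measure_pos:
  assumes "compact K" "interior K \<noteq> {}"
  shows "0 < measure m K"
proof -
  have "0 < emeasure m (interior K)" using assms by (intro emeasure_open_pos) auto
  also have "\<dots> \<le> emeasure m K"
    by (rule emeasure_mono) (auto simp: interior_subset compact_sets[OF assms(1)])
  finally show ?thesis
    using compact_finite[OF assms(1)] by (simp add: measure_def enn2real_positive_iff)
qed

text \<open>The reflected function is at least the indicator of - K, which has positive measure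
  because inversion is a homeomorphism and \<open>K\<close> has interior points.\<close>

lemma integral_uminus_pos:
  fixes \<psi> :: "'a \<Rightarrow> real"
  assumes \<psi>: "(\<lambda>s. complex_of_real (\<psi> s)) \<in> Cc" "\<And>s. 0 \<le> \<psi> s" "\<And>s. s \<in> K \<Longrightarrow> \<psi> s = 1"
    and K: "compact K" "interior K \<noteq> {}"
  obtains r where "0 < r" "(\<integral>x. complex_of_real (\<psi> (- x)) \<partial>m) = complex_of_real r"
proof -
  define K' where "K' = uminus ` K"
  have K': "compact K'" unfolding K'_def
    by (intro compact_continuous_image K continuous_intros)
  have "interior K' \<noteq> {}"
  proof -
    have "open (uminus -` interior K)"
      by (rule open_vimage) (auto intro!: continuous_intros)
    moreover have "uminus -` interior K \<subseteq> K'"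
    proof
      fix x assume "x \<in> uminus -` interior K"
      then show "x \<in> K'" unfolding K'_def using interior_subset
        by (intro image_eqI[of _ _ "- x"]) auto
    qed
    ultimately have "uminus -` interior K \<subseteq> interior K'" by (simp add: interior_maximal)
    moreover obtain x where "x \<in> interior K" using K by auto
    then have "- x \<in> uminus -` interior K" by simp
    ultimately show ?thesis by blast
  qed
  from measure_pos[OF K' this] have pos: "0 < measure m K'" .
  obtain D where D: "compact D" "\<And>s. s \<notin> D \<Longrightarrow> complex_of_real (\<psi> s) = 0"
    and cont: "continuous_on UNIV (\<lambda>s. complex_of_real (\<psi> s))"
    using \<psi>(1) by (auto simp: Cc_def)
  have "(\<lambda>x. complex_of_real (\<psi> (- x))) \<in> Cc"
    unfolding Cc_def
  proof (intro CollectI conjI exI[of _ "uminus ` D"] allI impI)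
    show "continuous_on UNIV (\<lambda>x. complex_of_real (\<psi> (- x)))"
      by (intro continuous_on_compose2[OF cont] continuous_intros) auto
    show "compact (uminus ` D)"
      by (intro compact_continuous_image D continuous_intros)
    fix s assume "s \<notin> uminus ` D"
    then have "- s \<notin> D" by (metis imageI minus_minus)
    then show "complex_of_real (\<psi> (- s)) = 0" by (rule D)
  qed
  from Cc_integrable[OF this] have int: "integrable m (\<lambda>x. \<psi> (- x))"
    by (simp add: complex_of_real_integrable_eq)
  have "measure m K' = (\<integral>x. indicator K' x \<partial>m)" by simp
  also have "\<dots> \<le> (\<integral>x. \<psi> (- x) \<partial>m)"
    by (rule integral_mono'[OF int]) (use \<psi>(2,3) in \<open>auto simp: indicator_def K'_def\<close>)
  finally have "0 < (\<integral>x. \<psi> (- x) \<partial>m)" using pos by simp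
  then show thesis by (intro that[of "\<integral>x. \<psi> (- x) \<partial>m"]) auto
qed

end

lemma (in lc_segal) constant_on_compact:
  assumes p: "1 < p" and K: "compact K" "interior K \<noteq> {}"
    and Ap: "\<And>u f. u \<in> Ap m p \<Longrightarrow> f \<in> S \<Longrightarrow> (\<lambda>s. u s * f s) \<in> S"
  obtains g c where "g \<in> S" "c \<noteq> 0" "\<And>s. s \<in> K \<Longrightarrow> g s = c"
proof -
  have mK: "0 < measure m K" by (rule measure_pos[OF K])
  obtain \<psi> where \<psi>: "(\<lambda>s. complex_of_real (\<psi> s)) \<in> Cc" "\<And>s. 0 \<le> \<psi> s" "\<And>s. s \<in> K \<Longrightarrow> \<psi> s = 1"
    by (rule Urysohn_compact[OF lc K(1) open_UNIV subset_UNIV]) (rule that)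
  obtain r where r: "0 < r" "(\<integral>x. complex_of_real (\<psi> (- x)) \<partial>m) = complex_of_real r"
    by (rule integral_uminus_pos[OF \<psi> K])
  obtain D where D: "compact D" "\<And>s. s \<notin> D \<Longrightarrow> \<psi> s = 0"
    using \<psi>(1) by (auto simp: Cc_def)
  obtain w E0 where w: "w \<in> Ap m p" "compact E0" "\<And>s. s \<notin> E0 \<Longrightarrow> w s = 0" "\<And>s. norm (w s) \<le> 1"
    "\<And>s. s \<in> D \<Longrightarrow> w s = 1"
    by (rule Ap_bump[OF p K(1) mK D(1)]) (rule that)
  \<comment> \<open>\<open>w\<close> is not known here to be continuous, so a second, continuous
    cutoff is taken. It is 1 where \<open>f\<close> may be non-zero; multiplying a continuous
    approximation of \<open>f\<close> by it confines the support to \<open>E\<close> without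
    increasing the error.\<close>
  obtain \<kappa> where \<kappa>: "(\<lambda>s. complex_of_real (\<kappa> s)) \<in> Cc" "\<And>s. 0 \<le> \<kappa> s" "\<And>s. \<kappa> s \<le> 1"
    "\<And>s. s \<in> E0 \<Longrightarrow> \<kappa> s = 1"
    by (rule Urysohn_compact[OF lc w(2) open_UNIV subset_UNIV]) (rule that)
  obtain E where E: "compact E" "\<And>s. s \<notin> E \<Longrightarrow> \<kappa> s = 0"
    using \<kappa>(1) by (auto simp: Cc_def)
  define H where "H = (\<lambda>(a, b). a - b) ` (K \<times> E)"
  \<comment> \<open>The strict excess over the measure of \<open>H\<close> allows division by
    \<open>h\<close> and yields the strict inequality in the proof of c \<noteq> 0.\<close>
  define h where "h = measure m H + 1"
  have mH: "0 < h" and Hh: "measure m H < h" by (simp_all add: h_def add_nonneg_pos)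
  text \<open>\<open>E\<close> and \<open>h\<close> do not depend on the approximation \<open>f0\<close> of \<open>\<psi>\<close>, so \<open>f0\<close> may be chosen afterwards.\<close>
  define d where "d = r * measure m K / h"
  have d: "0 < d" using r mK mH by (simp add: d_def)
  obtain f0 where f0: "f0 \<in> S" "(\<integral>s. norm (complex_of_real (\<psi> s) - f0 s) \<partial>m) < d"
    using dense[OF Cc_integrable[OF \<psi>(1)] d] by blast
  define f where "f s = w s * f0 s" for s
  have fS: "f \<in> S" unfolding f_def by (rule Ap[OF w(1) f0(1)])
  \<comment> \<open>Multiplication by \<open>w\<close> fixes \<open>\<psi>\<close> and does not
    increase absolute values.\<close>
  have f\<psi>: "(\<integral>s. norm (f s - complex_of_real (\<psi> s)) \<partial>m) < d"
  proof -
    have "norm (f s - complex_of_real (\<psi> s)) \<le> norm (complex_of_real (\<psi> s) - f0 s)" for s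
    proof -
      have "f s - complex_of_real (\<psi> s) = w s * (f0 s - complex_of_real (\<psi> s))"
        using w(5)[of s] D(2)[of s] by (cases "s \<in> D") (simp_all add: f_def right_diff_distrib)
      then show ?thesis
        using mult_right_mono[OF w(4)[of s], of "norm (f0 s - complex_of_real (\<psi> s))"]
        by (simp add: norm_mult norm_minus_commute)
    qed
    moreover have "integrable m (\<lambda>s. norm (complex_of_real (\<psi> s) - f0 s))"
      using Cc_integrable[OF \<psi>(1)] subset_L1[OF f0(1)] by auto
    ultimately have "(\<integral>s. norm (f s - complex_of_real (\<psi> s)) \<partial>m) \<le> (\<integral>s. norm (complex_of_real (\<psi> s) - f0 s) \<partial>m)"
      by (intro integral_mono') auto
    with f0(2) show ?thesis by simp
  qed
  have H: "compact H" unfolding H_def by (rule compact_diff_set[OF K(1) E(1)])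
  obtain g where g: "g \<in> S" and lim: "\<And>e. 0 < e \<Longrightarrow> \<exists>V. open V \<and> 0 \<in> V \<and> (\<forall>V' I A. V' \<subseteq> V \<longrightarrow>
      tagged_cells V' H I A \<longrightarrow> N (\<lambda>s. riemann I A f s - g s) \<le> e)"
    by (rule riemann_limit[OF fS H]) (rule that)
  note near = riemann_limit_near_constant[OF fS K(1) E(1) g lim[unfolded H_def], folded H_def]
  have intK: "integrable m (\<lambda>s. indicator K s * (g s - c))" for c
  proof -
    have "integrable m (\<lambda>s. indicator K s *\<^sub>R g s - indicator K s * c)"
      using subset_L1[OF g] compact_sets[OF K(1)] compact_finite[OF K(1)]
      by (intro Bochner_Integration.integrable_diff integrable_mult_indicator integrable_indicator_mult)
    moreover have "indicator K s *\<^sub>R g s - indicator K s * c = indicator K s * (g s - c)" for s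
      by (simp add: indicator_def)
    ultimately show ?thesis by simp
  qed
  have normK: "norm (indicator K s * z) = indicator K s * norm z" for s and z :: complex
    by (simp add: indicator_def)
  \<comment> \<open>As the mean of \<open>g\<close> over \<open>K\<close>, \<open>c\<close> is at
    least as close to any constant \<open>z\<close> as \<open>g\<close> is on average. So if
    \<open>g\<close> is near some constant up to every e, it is near \<open>c\<close>, and no
    convergence of those constants has to be shown.\<close>
  define c where "c = (\<integral>s. indicator K s * g s \<partial>m) / of_real (measure m K)"
  have mean: "(\<integral>s. indicator K s * (g s - z) \<partial>m) = of_real (measure m K) * (c - z)" for z
  proof -
    have "(\<integral>s. indicator K s * (g s - z) \<partial>m) = (\<integral>s. indicator K s * g s \<partial>m) - (\<integral>s. indicator K s * z \<partial>m)"
      using intK[of 0] integrable_indicator_mult[OF compact_sets[OF K(1)] compact_finite[OF K(1)], of z]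
      by (simp add: right_diff_distrib)
    then show ?thesis
      using integral_indicator_mult[OF compact_sets[OF K(1)] compact_finite[OF K(1)], of z] mK
      by (simp add: c_def right_diff_distrib)
  qed
  have mean_le: "measure m K * norm (c - z) \<le> (\<integral>s. indicator K s * norm (g s - z) \<partial>m)" for z
    using integral_norm_bound[of m "\<lambda>s. indicator K s * (g s - z)"] unfolding mean normK
    by (simp add: norm_mult)
  have approx: "(\<integral>s. indicator K s * norm (g s - c) \<partial>m) \<le> 0"
  proof (rule field_le_epsilon)
    fix e :: real assume e: "0 < e"
    define b where "b = e / (2 * h)"
    have b: "0 < b" using e mH by (simp add: b_def)
    obtain \<phi> where \<phi>: "\<phi> \<in> Cc" "(\<integral>s. norm (f s - \<phi> s) \<partial>m) < b"
      using Cc_dense[OF subset_L1[OF fS] b] by blast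
    define \<phi>' where "\<phi>' s = complex_of_real (\<kappa> s) * \<phi> s" for s
    have \<phi>': "\<phi>' \<in> Cc" "\<And>s. s \<notin> E \<Longrightarrow> \<phi>' s = 0"
      using \<kappa>(1) \<phi>(1) E by (auto simp: Cc_def \<phi>'_def intro!: continuous_intros exI[of _ E])
    have "norm (f s - \<phi>' s) \<le> norm (f s - \<phi> s)" for s
    proof -
      have "f s - \<phi>' s = complex_of_real (\<kappa> s) * (f s - \<phi> s)"
        using w(3)[of s] \<kappa>(4)[of s] by (cases "s \<in> E0") (simp_all add: f_def \<phi>'_def)
      then show ?thesis
        using mult_right_mono[OF \<kappa>(3)[of s], of "norm (f s - \<phi> s)"] \<kappa>(2)[of s] by (simp add: norm_mult)
    qed
    then have "(\<integral>s. norm (f s - \<phi>' s) \<partial>m) \<le> (\<integral>s. norm (f s - \<phi> s) \<partial>m)"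
      using subset_L1[OF fS] Cc_integrable[OF \<phi>(1)] by (intro integral_mono') auto
    with \<phi>(2) have "(\<integral>s. norm (f s - \<phi>' s) \<partial>m) \<le> b" by simp
    define z where "z = (\<integral>x. \<phi>' (- x) \<partial>m)"
    have "(\<integral>s. indicator K s * norm (g s - z) \<partial>m) \<le> measure m H * (\<integral>s. norm (f s - \<phi>' s) \<partial>m)"
      unfolding z_def by (rule near[OF _ \<phi>'])
    also have "\<dots> \<le> measure m H * b"
      using \<open>(\<integral>s. norm (f s - \<phi>' s) \<partial>m) \<le> b\<close> by (intro mult_left_mono) auto
    also have "\<dots> \<le> h * b"
      using b Hh by (intro mult_right_mono) auto
    also have "\<dots> = e / 2" using mH by (simp add: b_def)
    finally have gz: "(\<integral>s. indicator K s * norm (g s - z) \<partial>m) \<le> e / 2" .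
    have int1: "integrable m (\<lambda>s. indicator K s * norm (g s - z) :: real)"
      using integrable_norm[OF intK[of z]] by (simp only: normK)
    have int2: "integrable m (\<lambda>s. indicator K s * norm (c - z) :: real)"
      using compact_sets[OF K(1)] compact_finite[OF K(1)] by simp
    have "(\<integral>s. indicator K s * norm (g s - c) \<partial>m) \<le>
        (\<integral>s. indicator K s * norm (g s - z) + indicator K s * norm (c - z) \<partial>m)"
    proof (rule integral_mono')
      fix s
      have "norm (g s - c) \<le> norm (g s - z) + norm (c - z)"
        using norm_triangle_ineq4[of "g s - z" "c - z"] by simp
      then show "indicator K s * norm (g s - c) \<le> indicator K s * norm (g s - z) + indicator K s * norm (c - z)"
        by (simp add: indicator_def)
    qed (use int1 int2 in auto)
    also have "\<dots> = (\<integral>s. indicator K s * norm (g s - z) \<partial>m) + measure m K * norm (c - z)"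
      using int1 int2 by simp
    also have "\<dots> \<le> 0 + e" using gz mean_le[of z] by simp
    finally show "(\<integral>s. indicator K s * norm (g s - c) \<partial>m) \<le> 0 + e" .
  qed
  have ae: "AE s in m. indicator K s * norm (g s - c) = 0"
  proof -
    have "integrable m (\<lambda>s. indicator K s * norm (g s - c) :: real)"
      using integrable_norm[OF intK[of c]] by (simp only: normK)
    moreover have "(\<integral>s. indicator K s * norm (g s - c) \<partial>m) = 0"
      using approx by (intro antisym) (auto intro: integral_nonneg)
    ultimately show ?thesis
      by (subst (asm) integral_nonneg_eq_0_iff_AE) auto
  qed
  have "c \<noteq> 0"
  proof
    assume "c = 0"
    \<comment> \<open>\<open>D\<close> lies in \<open>E0\<close> because \<open>w\<close> is 1 on
      \<open>D\<close>, and \<open>E0\<close> lies in \<open>E\<close> because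
      \<open>\<kappa>\<close> is 1 on \<open>E0\<close>.\<close>
    have \<psi>E: "complex_of_real (\<psi> s) = 0" if "s \<notin> E" for s
    proof -
      have "s \<notin> E0" using E(2)[OF that] \<kappa>(4)[of s] by auto
      then have "s \<notin> D" using w(3)[of s] w(5)[of s] by auto
      then show ?thesis using D(2) by simp
    qed
    \<comment> \<open>Now \<open>\<psi>\<close> itself is the continuous function compared with
      \<open>f\<close>. Its constant is \<open>r\<close>, at distance \<open>r\<close> from the
      supposed mean 0, and \<open>d\<close> was chosen so that this is too far.\<close>
    have "measure m K * r \<le> (\<integral>s. indicator K s * norm (g s - complex_of_real r) \<partial>m)"
      using mean_le[of "complex_of_real r"] r(1) \<open>c = 0\<close> by simp
    also have "\<dots> \<le> measure m H * (\<integral>s. norm (f s - complex_of_real (\<psi> s)) \<partial>m)"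
      using near[OF _ \<psi>(1) \<psi>E] unfolding r(2) by simp
    also have "\<dots> \<le> measure m H * d"
      using f\<psi> by (intro mult_left_mono) auto
    also have "\<dots> < h * d"
      using d Hh by simp
    also have "\<dots> = measure m K * r" using mH by (simp add: d_def)
    finally show False by simp
  qed
  text \<open>Making \<open>g\<close> equal to \<open>c\<close> everywhere on \<open>K\<close>, not just almost everywhere, lets one write
    \<open>u = (u * g') / c\<close> pointwise without knowing that \<open>u\<close> is measurable.\<close>
  define g' where "g' s = (if s \<in> K then c else g s)" for s
  have "g' \<in> S"
  proof (rule AE_closed[OF g])
    show "g' \<in> borel_measurable m"
      unfolding g'_def using subset_L1[OF g] compact_sets[OF K(1)]
      by (intro measurable_If_set) auto
    show "AE s in m. g s = g' s"
      using ae by eventually_elim (auto simp: g'_def)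
  qed
  then show thesis using \<open>c \<noteq> 0\<close> by (rule that) (simp add: g'_def)
qed

section \<open>The inclusion of the Feichtinger algebra\<close>

theorem theorem2p7:
  fixes m :: "'a::{topological_group_add,t2_space} measure"
    and p :: real
    and K :: "'a set"
    and S :: "('a \<Rightarrow> complex) set"
    and N :: "('a \<Rightarrow> complex) \<Rightarrow> real"
  assumes "locally_compact_space (euclidean :: 'a topology)"
    and "left_haar_measure m"
    and "1 < p"
    and "compact K" and "interior K \<noteq> {}"
    and "segal_algebra m S N"
    and "\<And>u f. u \<in> Ap m p \<Longrightarrow> f \<in> S \<Longrightarrow> (\<lambda>s. u s * f s) \<in> S"
  shows "S0p m p K \<subseteq> S"
proof -
  interpret segal_algebra m S N by fact
  interpret lc_segal m S N
    by unfold_locales (use assms in auto)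
  interpret A: sup_dominated "Ap_supp m p K" "Ap_norm m p"
    by (rule sup_dominated_Ap_supp[OF assms(3) compact_imp_closed[OF assms(4)]])
  have sub: "Ap_supp m p K \<subseteq> S"
  proof
    fix u assume u: "u \<in> Ap_supp m p K"
    obtain g c where g: "g \<in> S" "c \<noteq> 0" "\<And>s. s \<in> K \<Longrightarrow> g s = c"
      using constant_on_compact[OF assms(3-5)] assms(7) by metis
    have u': "u \<in> Ap m p" "\<And>s. s \<notin> K \<Longrightarrow> u s = 0"
      using u closure_support_subset[OF compact_imp_closed[OF assms(4)], of u] by (auto simp: Ap_supp_def)
    \<comment> \<open>Off \<open>K\<close> both sides are 0, whatever \<open>g\<close> is
      there.\<close>
    have "u s = inverse c * (u s * g s)" for s
      using u'(2)[of s] g(2) g(3)[of s] by (cases "s \<in> K") auto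
    then have "u = (\<lambda>s. inverse c * (u s * g s))" by blast
    also have "\<dots> \<in> S" by (intro scale_mem assms(7) u' g)
    finally show "u \<in> S" .
  qed
  obtain C where C: "\<And>u. u \<in> Ap_supp m p K \<Longrightarrow> N u \<le> C * Ap_norm m p u"
    by (rule A.inclusion_bounded[OF sum_normed sub]) blast
  show ?thesis
  proof
    fix F assume "F \<in> S0p m p K"
    then obtain v where F: "F = (\<lambda>s. \<Sum>\<^sub>\<infinity>t. ltranslate t (v t) s)"
      and v: "\<And>t. v t \<in> Ap_supp m p K" and sum: "(\<lambda>t. Ap_norm m p (v t)) summable_on UNIV"
      by (auto simp: S0p_def)
    \<comment> \<open>A summable family has only countably many non-zero norms, and norm zero means
      the zero function. Enumerating \<open>T\<close> turns the sum over the group into an ordinary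
      series.\<close>
    define T where "T = {t. Ap_norm m p (v t) \<noteq> 0}"
    have "countable T"
      using summable_countable_real[OF sum] by (simp add: T_def)
    define e where "e = to_nat_on T"
    have e: "inj_on e T" unfolding e_def by (rule inj_on_to_nat_on[OF \<open>countable T\<close>])
    define d where "d = inv_into T e"
    have d: "d (e t) = t" if "t \<in> T" for t
      unfolding d_def using e that by simp
    have v0: "v t = (\<lambda>_. 0)" if "t \<notin> T" for t
      using A.norm_le_nrm[OF v, of t] that by (auto simp: T_def)
    \<comment> \<open>Indices that enumerate nothing, as when \<open>T\<close> is finite, are filled
      with 0.\<close>
    define a where "a n = (if n \<in> e ` T then ltranslate (d n) (v (d n)) else (\<lambda>_. 0))" for n
    define b where "b n = (if n \<in> e ` T then Ap_norm m p (v (d n)) else 0)" for n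
    have transfer: "((\<lambda>n. if n \<in> e ` T then h (d n) else 0) has_sum x) UNIV"
      if "(h has_sum x) UNIV" "\<And>t. t \<notin> T \<Longrightarrow> h t = 0" for h :: "'a \<Rightarrow> 'b::{comm_monoid_add,topological_space}" and x
    proof -
      have "(h has_sum x) T"
        using that by (subst has_sum_cong_neutral[of UNIV T h h x]) auto
      then have "((\<lambda>n. h (d n)) has_sum x) (e ` T)"
        using has_sum_cong[of T "\<lambda>t. h (d (e t))" h] d by (subst has_sum_reindex[OF e]) (auto simp: o_def)
      then show ?thesis
        by (rule iffD1[OF has_sum_cong_neutral, rotated -1]) auto
    qed
    have "(b has_sum (\<Sum>\<^sub>\<infinity>t. Ap_norm m p (v t))) UNIV"
      unfolding b_def by (rule transfer) (use has_sum_infsum[OF sum] in \<open>auto simp: T_def\<close>)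
    then have sb: "summable b" by (intro sums_summable[OF has_sum_imp_sums])
    have vS: "v t \<in> S" for t using v sub by blast
    have aS: "a n \<in> S" for n
      unfolding a_def using vS zero_mem by (auto intro: ltranslate_mem)
    \<comment> \<open>Translations are isometric for \<open>N\<close>, so the bound for the
      untranslated \<open>v (d n)\<close> is enough.\<close>
    have aN: "N (a n) \<le> C * b n" for n
      using C[OF v] by (simp add: a_def b_def ltranslate_isometric[OF vS] norm_zero_fun)
    have "summable (\<lambda>n. N (a n))"
      by (rule summable_comparison_test[OF _ summable_mult[OF sb, of C]])
        (use aN norm_nonneg[OF aS] in auto)
    moreover have "(\<lambda>n. a n s) sums F s" for s
    proof -
      have "(\<lambda>t. norm (ltranslate t (v t) s)) summable_on UNIV"
        by (rule summable_on_comparison_test[OF sum]) (use A.norm_le_nrm[OF v] in \<open>auto simp: ltranslate_def\<close>)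
      then have "(\<lambda>t. ltranslate t (v t) s) summable_on UNIV"
        by (rule abs_summable_summable)
      then have "((\<lambda>t. ltranslate t (v t) s) has_sum F s) UNIV"
        by (simp add: F)
      from transfer[OF this] have "((\<lambda>n. if n \<in> e ` T then ltranslate (d n) (v (d n)) s else 0) has_sum F s) UNIV"
        using v0 by (auto simp: ltranslate_def)
      moreover have "(\<lambda>n. if n \<in> e ` T then ltranslate (d n) (v (d n)) s else 0) = (\<lambda>n. a n s)"
        by (auto simp: a_def)
      ultimately show ?thesis by (simp add: has_sum_imp_sums)
    qed
    ultimately show "F \<in> S" by (rule series_mem[OF aS])
  qed
qed

end
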